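(* (Exact Pair Theorem) Let $(A_i)_{i\in\omega}$ be a uniformly c.e. sequence of ceers. Then there exist ceers $X$ and $Y$ such that $\bigoplus_{i\leq n}A_i\leq X$ and $\bigoplus_{i\leq n}A_i\leq Y$ for every $n$, and such that every ceer $Z$ with $Z\leq X$ and $Z\leq Y$ satisfies $Z\leq\bigoplus_{i\leq n}A_i$ for some $n$. Further, if each $A_i$ is either dark or has only finitely many classes, then $X$ and $Y$ can be chosen to be dark.
   Context: A ceer is a computably enumerable equivalence relation on $\omega$. For equivalence relations $E,R$ on $\omega$, $E\leq R$ means there is a computable $f$ with $x\mathrel{E}y\iff f(x)\mathrel{R}f(y)$ for all $x,y$. A sequence of ceers $(A_i)$ is uniformly c.e. if $\{(i,x,y)\mid x\mathrel{A_i}y\}$ is c.e. For $m\geq1$ the finite uniform join $\bigoplus_{i<m}A_i$ is the equivalence relation in which $x,y$ are equivalent iff there is $i<m$ with $x\equiv y\equiv i\pmod m$ and $\frac{x-i}{m}\mathrel{A_i}\frac{y-i}{m}$; $\bigoplus_{i\leq n}A_i$ means $\bigoplus_{i<n+1}A_i$. $\mathrm{Id}$ is equality on $\omega$. A ceer $R$ is dark if it has infinitely many classes and $\mathrm{Id}\not\leq R$. *)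

theory Defs
  imports Main "HOL-Library.Nat_Bijection"
begin

text \<open>
  Partial computable functions are the partial \<open>\<mu>\<close>-recursive functions.  They are presented as
  unary functions; several arguments are packed into one with the Cantor pairing
  \<^const>\<open>prod_encode\<close>, whose inverse projections are among the basic functions.
\<close>

primrec prim_rec :: "(nat \<rightharpoonup> nat) \<Rightarrow> (nat \<rightharpoonup> nat) \<Rightarrow> nat \<Rightarrow> (nat \<rightharpoonup> nat)" where
  "prim_rec f g a 0 = f a"
| "prim_rec f g a (Suc n) =
     Option.bind (prim_rec f g a n) (\<lambda>r. g (prod_encode (a, prod_encode (n, r))))"

text \<open>Unbounded search diverges if some value inspected before the first zero is undefined.\<close>

definition mu_search :: "(nat \<rightharpoonup> nat) \<Rightarrow> (nat \<rightharpoonup> nat)" where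
  "mu_search f a =
     (if \<exists>n. f (prod_encode (a, n)) = Some 0 \<and>
             (\<forall>k<n. \<exists>r. f (prod_encode (a, k)) = Some (Suc r))
      then Some (LEAST n. f (prod_encode (a, n)) = Some 0)
      else None)"

inductive partial_computable :: "(nat \<rightharpoonup> nat) \<Rightarrow> bool" where
  zero: "partial_computable (\<lambda>x. Some 0)"
| succ: "partial_computable (\<lambda>x. Some (Suc x))"
| left: "partial_computable (\<lambda>x. Some (fst (prod_decode x)))"
| right: "partial_computable (\<lambda>x. Some (snd (prod_decode x)))"
| pair: "partial_computable f \<Longrightarrow> partial_computable g \<Longrightarrow>
    partial_computable
      (\<lambda>x. Option.bind (f x) (\<lambda>u. Option.bind (g x) (\<lambda>v. Some (prod_encode (u, v)))))"
| comp: "partial_computable f \<Longrightarrow> partial_computable g \<Longrightarrow>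
    partial_computable (\<lambda>x. Option.bind (g x) f)"
| prec: "partial_computable f \<Longrightarrow> partial_computable g \<Longrightarrow>
    partial_computable (\<lambda>x. prim_rec f g (fst (prod_decode x)) (snd (prod_decode x)))"
| mu: "partial_computable f \<Longrightarrow> partial_computable (mu_search f)"

definition computable :: "(nat \<Rightarrow> nat) \<Rightarrow> bool" where
  "computable f \<longleftrightarrow> partial_computable (\<lambda>x. Some (f x))"

definition ce :: "nat set \<Rightarrow> bool" where
  "ce S \<longleftrightarrow> (\<exists>f. partial_computable f \<and> S = dom f)"

definition ceer :: "nat rel \<Rightarrow> bool" where
  "ceer E \<longleftrightarrow> equiv UNIV E \<and> ce (prod_encode ` E)"

definition uniformly_ce :: "(nat \<Rightarrow> nat rel) \<Rightarrow> bool" where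
  "uniformly_ce A \<longleftrightarrow> ce {prod_encode (i, prod_encode (x, y)) | i x y. (x, y) \<in> A i}"

definition reducible :: "nat rel \<Rightarrow> nat rel \<Rightarrow> bool" (infix "\<preceq>" 50) where
  "E \<preceq> R \<longleftrightarrow> (\<exists>f. computable f \<and> (\<forall>x y. (x, y) \<in> E \<longleftrightarrow> (f x, f y) \<in> R))"

definition uniform_join :: "nat \<Rightarrow> (nat \<Rightarrow> nat rel) \<Rightarrow> nat rel" where
  "uniform_join m A =
     {(x, y). \<exists>i<m. x mod m = i \<and> y mod m = i \<and> ((x - i) div m, (y - i) div m) \<in> A i}"

definition dark :: "nat rel \<Rightarrow> bool" where
  "dark R \<longleftrightarrow> ceer R \<and> infinite (UNIV // R) \<and> \<not> Id \<preceq> R"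

definition exact_pair :: "(nat \<Rightarrow> nat rel) \<Rightarrow> nat rel \<Rightarrow> nat rel \<Rightarrow> bool" where
  "exact_pair A X Y \<longleftrightarrow>
     ceer X \<and> ceer Y \<and>
     (\<forall>n. uniform_join (n + 1) A \<preceq> X \<and> uniform_join (n + 1) A \<preceq> Y) \<and>
     (\<forall>Z. ceer Z \<longrightarrow> Z \<preceq> X \<longrightarrow> Z \<preceq> Y \<longrightarrow> (\<exists>n. Z \<preceq> uniform_join (n + 1) A))"

end

theory Submission imports Defs begin

text \<open>
  A finite-injury construction.  Columns of \<open>\<omega>\<close> are assigned to the \<open>A i\<close>, and \<open>A i\<close> is copied into
  its column both in \<open>X\<close> and in \<open>Y\<close>.  For a pair \<open>(f, g)\<close>, the requirement with number \<open>e\<close> looks for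
  \<open>z, z'\<close> such that \<open>f z\<close> is not \<open>X\<close>-equivalent to an element of the columns of \<open>A 0, \<dots>, A e\<close>, while
  \<open>g z\<close> and \<open>g z'\<close> are not \<open>Y\<close>-equivalent and not both equivalent to elements of the same one of these
  columns.  It then collapses \<open>f z\<close> and \<open>f z'\<close> in \<open>X\<close> and moves the columns of all \<open>A i\<close> with \<open>i > e\<close>
  to fresh places, which keeps \<open>g z\<close> and \<open>g z'\<close> apart in \<open>Y\<close>.  If no such \<open>z, z'\<close> exist and \<open>Z\<close> is the
  preimage of \<open>X\<close> under \<open>f\<close> and of \<open>Y\<close> under \<open>g\<close>, then either all \<open>f z\<close>, or all \<open>g z\<close>, are
  equivalent to elements of the first \<open>e + 1\<close> columns, or \<open>Z\<close> has a single class; in each case \<open>Z\<close>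
  reduces to the join of \<open>A 0, \<dots>, A e\<close>.

  Similarly, the darkness requirement for \<open>f\<close> collapses two values of \<open>f\<close> unless almost all values are
  equivalent to elements of the first \<open>e + 1\<close> columns; a reduction \<open>f\<close> of \<open>Id\<close> would then give one
  to the join of \<open>A 0, \<dots>, A e\<close>, which is impossible if these are dark or have finitely many classes.
\<close>

section \<open>Closure properties of computable functions\<close>

abbreviation pr :: "nat \<Rightarrow> nat \<Rightarrow> nat" where "pr x y \<equiv> prod_encode (x, y)"
abbreviation p1 :: "nat \<Rightarrow> nat" where "p1 x \<equiv> fst (prod_decode x)"
abbreviation p2 :: "nat \<Rightarrow> nat" where "p2 x \<equiv> snd (prod_decode x)"

named_theorems computable_intros

lemma computable_comp: "computable f \<Longrightarrow> computable g \<Longrightarrow> computable (\<lambda>x. f (g x))"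
  unfolding computable_def by (drule (1) partial_computable.comp) simp

lemma computable_pair [computable_intros]:
  "computable f \<Longrightarrow> computable g \<Longrightarrow> computable (\<lambda>x. pr (f x) (g x))"
  unfolding computable_def by (drule (1) partial_computable.pair) simp

lemma computable_Suc [computable_intros]: "computable f \<Longrightarrow> computable (\<lambda>x. Suc (f x))"
  by (rule computable_comp[of Suc]) (simp_all add: computable_def partial_computable.succ)

lemma computable_p1 [computable_intros]: "computable f \<Longrightarrow> computable (\<lambda>x. p1 (f x))"
  by (rule computable_comp[of p1]) (simp_all add: computable_def partial_computable.left)

lemma computable_p2 [computable_intros]: "computable f \<Longrightarrow> computable (\<lambda>x. p2 (f x))"
  by (rule computable_comp[of p2]) (simp_all add: computable_def partial_computable.right)

lemma computable_id [computable_intros]: "computable (\<lambda>x. x)"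
proof -
  have "computable (\<lambda>x. pr (p1 x) (p2 x))"
    by (rule computable_pair) (simp_all add: computable_def partial_computable.left partial_computable.right)
  then show ?thesis by simp
qed

lemma computable_const [computable_intros]: "computable (\<lambda>x. c)"
proof (induction c)
  case 0
  show ?case by (simp add: computable_def partial_computable.zero)
qed (rule computable_Suc)

text \<open>\<open>prim_rec\<close> carries a fixed parameter. Taking the whole input
  \<open>x\<close> as this parameter lets the step depend on \<open>x\<close>; the length
  \<open>n x\<close> is substituted afterwards.\<close>

lemma computable_rec [computable_intros]:
  assumes "computable a" "computable n"
    and "computable (\<lambda>p. g (p1 p) (p1 (p2 p)) (p2 (p2 p)))"
  shows "computable (\<lambda>x. rec_nat (a x) (g x) (n x))"
proof -
  let ?a = "\<lambda>x. Some (a x)" and ?g = "\<lambda>p. Some (g (p1 p) (p1 (p2 p)) (p2 (p2 p)))"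
  have "prim_rec ?a ?g x k = Some (rec_nat (a x) (g x) k)" for x k
    by (induction k) simp_all
  moreover have "partial_computable (\<lambda>x. prim_rec ?a ?g (p1 x) (p2 x))"
    using assms(1,3) unfolding computable_def by (rule partial_computable.prec)
  ultimately have *: "computable (\<lambda>x. rec_nat (a (p1 x)) (g (p1 x)) (p2 x))"
    by (simp add: computable_def)
  have "computable (\<lambda>x. pr x (n x))" by (intro computable_intros assms)
  from computable_comp[OF * this] show ?thesis by simp
qed

definition decidable :: "(nat \<Rightarrow> bool) \<Rightarrow> bool" where
  "decidable P \<longleftrightarrow> computable (\<lambda>x. if P x then 1 else 0)"

lemma computable_if [computable_intros]:
  assumes "decidable P" "computable f" "computable g"
  shows "computable (\<lambda>x. if P x then f x else g x)"
proof -
  \<comment> \<open>A recursion of length 0 or 1 whose step discards its arguments acts as a case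
    distinction.\<close>
  have "computable (\<lambda>x. rec_nat (g x) (\<lambda>k r. f x) (if P x then 1 else 0))"
    using assms(1) unfolding decidable_def
    by (intro computable_intros assms computable_comp[OF assms(2)])
  then show ?thesis by (rule back_subst[of computable]) auto
qed

lemma decidable_not [computable_intros]: "decidable P \<Longrightarrow> decidable (\<lambda>x. \<not> P x)"
  unfolding decidable_def[of "\<lambda>x. \<not> P x"]
  using computable_if[OF _ computable_const[of 0] computable_const[of 1], of P]
  by (auto elim!: back_subst[of computable])

lemma decidable_conj [computable_intros]:
  "decidable P \<Longrightarrow> decidable Q \<Longrightarrow> decidable (\<lambda>x. P x \<and> Q x)"
proof -
  assume "decidable P" "decidable Q"
  then have "computable (\<lambda>x. if P x then if Q x then 1 else 0 else 0)"
    by (intro computable_intros)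
  then show ?thesis unfolding decidable_def by (rule back_subst[of computable]) auto
qed

lemma decidable_disj [computable_intros]:
  "decidable P \<Longrightarrow> decidable Q \<Longrightarrow> decidable (\<lambda>x. P x \<or> Q x)"
  using decidable_not[OF decidable_conj[OF decidable_not decidable_not]] by simp

lemma computable_minus [computable_intros]:
  assumes "computable f" "computable g"
  shows "computable (\<lambda>x. f x - g x)"
proof -
  have pred: "computable (\<lambda>x. rec_nat 0 (\<lambda>k r. k) (h x))" if "computable h" for h
    by (intro computable_intros that)
  have *: "rec_nat a (\<lambda>k r. rec_nat 0 (\<lambda>k r. k) r) b = a - b" for a b :: nat
  proof -
    have "rec_nat 0 (\<lambda>k r. k) r = r - 1" for r :: nat by (cases r) simp_all
    then show ?thesis by (induction b) simp_all
  qed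
  have "computable (\<lambda>x. rec_nat (f x) (\<lambda>k r. rec_nat 0 (\<lambda>k r. k) r) (g x))"
    by (intro computable_intros assms)
  then show ?thesis unfolding * .
qed

lemma decidable_le [computable_intros]:
  assumes "computable f" "computable g"
  shows "decidable (\<lambda>x. f x \<le> g x)"
proof -
  have "computable (\<lambda>x. 1 - (f x - g x))" by (intro computable_intros assms)
  then show ?thesis unfolding decidable_def by (rule back_subst[of computable]) auto
qed

lemma decidable_less [computable_intros]:
  "computable f \<Longrightarrow> computable g \<Longrightarrow> decidable (\<lambda>x. f x < g x)"
  using decidable_le[OF computable_Suc] by (simp add: Suc_le_eq)

lemma decidable_eq [computable_intros]:
  assumes "computable f" "computable g"
  shows "decidable (\<lambda>x. f x = g x)"
proof -
  have "decidable (\<lambda>x. f x \<le> g x \<and> g x \<le> f x)" by (intro computable_intros assms)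
  then show ?thesis by (simp add: eq_iff)
qed

lemma computable_plus [computable_intros]:
  assumes "computable f" "computable g"
  shows "computable (\<lambda>x. f x + g x)"
proof -
  have *: "rec_nat a (\<lambda>k r. Suc r) b = a + b" for a b :: nat by (induction b) simp_all
  have "computable (\<lambda>x. rec_nat (f x) (\<lambda>k r. Suc r) (g x))" by (intro computable_intros assms)
  then show ?thesis unfolding * .
qed

lemma computable_times [computable_intros]:
  assumes "computable f" "computable g"
  shows "computable (\<lambda>x. f x * g x)"
proof -
  have *: "rec_nat 0 (\<lambda>k r. r + a) b = a * b" for a b :: nat by (induction b) simp_all
  have "computable (\<lambda>x. rec_nat 0 (\<lambda>k r. r + f x) (g x))"
    by (intro computable_intros assms computable_comp[OF assms(1)])
  then show ?thesis unfolding * .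
qed

text \<open>For a total test no undefined value can block the search, so it stops at the least
  witness whenever there is one.\<close>

lemma mu_search_total:
  "mu_search (\<lambda>p. Some (if R (p1 p) (p2 p) then 0 else 1)) x =
    (if \<exists>d. R x d then Some (LEAST d. R x d) else None)"
proof (cases "\<exists>d. R x d")
  case True
  then have "R x (LEAST d. R x d)" by (auto intro: LeastI)
  then have "\<exists>n. R x n \<and> (\<forall>k. R x k \<longrightarrow> \<not> k < n)"
    by (intro exI[of _ "LEAST d. R x d"]) (auto dest: not_less_Least)
  moreover have "(if R x n then 0 else 1) = (0::nat) \<longleftrightarrow> R x n" for n by simp
  ultimately show ?thesis using True by (simp add: mu_search_def)
qed (simp add: mu_search_def)

lemma ce_ex:
  assumes "decidable (\<lambda>p. R (p1 p) (p2 p))"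
  shows "ce {x. \<exists>d. R x d}"
proof -
  have "computable (\<lambda>p. if R (p1 p) (p2 p) then 0 else 1)" by (intro computable_intros assms)
  then have "partial_computable (mu_search (\<lambda>p. Some (if R (p1 p) (p2 p) then 0 else 1)))"
    unfolding computable_def by (rule partial_computable.mu)
  moreover have "dom (mu_search (\<lambda>p. Some (if R (p1 p) (p2 p) then 0 else 1))) = {x. \<exists>d. R x d}"
    by (auto simp: mu_search_total dom_def)
  ultimately show ?thesis unfolding ce_def by metis
qed

lemma computable_Least:
  assumes "decidable (\<lambda>p. R (p1 p) (p2 p))" "\<And>x. \<exists>d. R x d"
  shows "computable (\<lambda>x. LEAST d. R x d)"
proof -
  have "computable (\<lambda>p. if R (p1 p) (p2 p) then 0 else 1)" by (intro computable_intros assms)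
  then have "partial_computable (mu_search (\<lambda>p. Some (if R (p1 p) (p2 p) then 0 else 1)))"
    unfolding computable_def by (rule partial_computable.mu)
  moreover have "mu_search (\<lambda>p. Some (if R (p1 p) (p2 p) then 0 else 1)) = (\<lambda>x. Some (LEAST d. R x d))"
    using assms(2) by (simp add: mu_search_total fun_eq_iff)
  ultimately show ?thesis unfolding computable_def by simp
qed

lemma computable_div:
  assumes "computable f" "0 < m"
  shows "computable (\<lambda>x. f x div m)"
proof -
  have "computable (\<lambda>x. LEAST q. x < m * Suc q)"
  proof (rule computable_Least)
    show "decidable (\<lambda>p. p1 p < m * Suc (p2 p))" by (intro computable_intros)
    show "\<exists>q. x < m * Suc q" for x
      using dividend_less_times_div[OF assms(2), of x] by (intro exI[of _ "x div m"]) simp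
  qed
  moreover have "(LEAST q. x < m * Suc q) = x div m" for x
  proof (rule Least_equality)
    show "x < m * Suc (x div m)" using dividend_less_times_div[OF assms(2), of x] by simp
    show "x div m \<le> q" if "x < m * Suc q" for q
      using that assms(2) by (simp add: div_less_iff_less_mult mult.commute flip: less_Suc_eq_le)
  qed
  ultimately have "computable (\<lambda>x. x div m)" by simp
  then show ?thesis using assms(1) by (rule computable_comp)
qed

lemma computable_mod:
  assumes "computable f" "0 < m"
  shows "computable (\<lambda>x. f x mod m)"
  unfolding minus_mult_div_eq_mod[symmetric]
  by (intro computable_intros computable_div assms)

text \<open>The function \<open>m\<close> may be noncomputable: its first \<open>n\<close> values
  enter as constants. Final marker values are built into reductions in this nonuniform way.\<close>

lemma computable_finite_table:
  assumes "computable f"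
  shows "computable (\<lambda>x. if f x < n then m (f x) else 0)"
proof (induction n)
  case (Suc n)
  have "computable (\<lambda>x. if f x = n then m n else if f x < n then m (f x) else 0)"
    by (intro computable_intros assms Suc)
  then show ?case by (rule back_subst[of computable]) (auto simp: less_Suc_eq)
qed (simp add: computable_const)

section \<open>Course-of-values recursion\<close>

text \<open>A history of length \<open>s\<close> is the nested pair of the values at \<open>s - 1, \<dots>, 0\<close>.\<close>

definition lookup :: "nat \<Rightarrow> nat \<Rightarrow> nat \<Rightarrow> nat" where
  "lookup H s j = p1 (rec_nat H (\<lambda>k r. p2 r) (s - Suc j))"

text \<open>The history below \<open>s\<close> is a single number extended by primitive recursion,
  and \<open>local\<close> allows \<open>step\<close> to be run on the decoded history. Assumption
  \<open>comp\<close> is uniform in a parameter \<open>x\<close>, here coding a history together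
  with a stage.\<close>

theorem course_of_values:
  fixes step :: "(nat \<Rightarrow> nat) \<Rightarrow> nat \<Rightarrow> nat"
  assumes local: "\<And>w w' s. (\<And>j. j < s \<Longrightarrow> w j = w' j) \<Longrightarrow> step w s = step w' s"
    and comp: "\<And>W. computable (\<lambda>p. W (p1 p) (p2 p)) \<Longrightarrow> computable (\<lambda>x. step (W x) (p2 x))"
  obtains v where "computable v" "\<And>s. v s = step v s"
proof -
  define hist where "hist = rec_nat 0 (\<lambda>s H. pr (step (lookup H s) s) H)"
  define v where "v s = step (lookup (hist s) s) s" for s
  have hist: "hist (Suc s) = pr (v s) (hist s)" for s
    by (simp add: hist_def v_def)
  have step_comp: "computable (\<lambda>x. step (lookup (p1 x) (p2 x)) (p2 x))"
    by (rule comp) (unfold lookup_def, intro computable_intros)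
  have "computable hist"
    unfolding hist_def
    by (intro computable_intros)
      (use computable_comp[OF step_comp, of "\<lambda>p. pr (p2 (p2 p)) (p1 (p2 p))"] in
        \<open>simp add: computable_intros\<close>)
  then have "computable v"
    unfolding v_def
    using computable_comp[OF step_comp, of "\<lambda>s. pr (hist s) s"]
    by (simp add: computable_intros)
  moreover have "v s = step v s" for s
  proof -
    have "rec_nat (hist s) (\<lambda>k r. p2 r) k = hist (s - k)" if "k \<le> s" for k
      using that
    proof (induction k)
      case (Suc k)
      then have "s - k = Suc (s - Suc k)" by simp
      with Suc show ?case by (simp add: hist)
    qed simp
    then have "lookup (hist s) s j = v j" if "j < s" for j
      using that by (simp add: lookup_def hist)
    then have "step (lookup (hist s) s) s = step v s" by (rule local)
    then show ?thesis by (simp add: v_def)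
  qed
  ultimately show ?thesis by (rule that)
qed

section \<open>A universal enumeration of the partial computable functions\<close>

text \<open>Tag 8 is the search for a zero starting from a given argument; splitting it off from
  \<open>\<mu>\<close> (tag 7) leaves every rule with at most two premises.\<close>

inductive ev :: "nat \<Rightarrow> nat \<Rightarrow> nat \<Rightarrow> bool" where
  ev_zero: "ev (pr 0 a) x 0"
| ev_succ: "ev (pr 1 a) x (Suc x)"
| ev_left: "ev (pr 2 a) x (p1 x)"
| ev_right: "ev (pr 3 a) x (p2 x)"
| ev_pair: "ev a x u \<Longrightarrow> ev b x v \<Longrightarrow> ev (pr 4 (pr a b)) x (pr u v)"
| ev_comp: "ev b x u \<Longrightarrow> ev a u y \<Longrightarrow> ev (pr 5 (pr a b)) x y"
| ev_prec_0: "ev a x y \<Longrightarrow> ev (pr 6 (pr a b)) (pr x 0) y"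
| ev_prec_Suc: "ev (pr 6 (pr a b)) (pr x n) r \<Longrightarrow> ev b (pr x (pr n r)) y \<Longrightarrow>
    ev (pr 6 (pr a b)) (pr x (Suc n)) y"
| ev_mu: "ev (pr 8 a) (pr x 0) y \<Longrightarrow> ev (pr 7 a) x y"
| ev_found: "ev a (pr x n) 0 \<Longrightarrow> ev (pr 8 a) (pr x n) n"
| ev_next: "ev a (pr x n) (Suc r) \<Longrightarrow> ev (pr 8 a) (pr x (Suc n)) y \<Longrightarrow> ev (pr 8 a) (pr x n) y"

lemma ev_zero_iff: "ev (pr 0 a) x y \<longleftrightarrow> y = 0"
  by (subst ev.simps) simp

lemma ev_succ_iff: "ev (pr 1 a) x y \<longleftrightarrow> y = Suc x"
  by (subst ev.simps) simp

lemma ev_left_iff: "ev (pr 2 a) x y \<longleftrightarrow> y = p1 x"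
  by (subst ev.simps) simp

lemma ev_right_iff: "ev (pr 3 a) x y \<longleftrightarrow> y = p2 x"
  by (subst ev.simps) simp

lemma ev_pair_iff: "ev (pr 4 (pr a b)) x y \<longleftrightarrow> (\<exists>u v. ev a x u \<and> ev b x v \<and> y = pr u v)"
  by (subst ev.simps) auto

lemma ev_comp_iff: "ev (pr 5 (pr a b)) x y \<longleftrightarrow> (\<exists>u. ev b x u \<and> ev a u y)"
  by (subst ev.simps) simp

lemma ev_prec_0_iff: "ev (pr 6 (pr a b)) (pr x 0) y \<longleftrightarrow> ev a x y"
  by (subst ev.simps) simp

lemma ev_prec_Suc_iff:
  "ev (pr 6 (pr a b)) (pr x (Suc n)) y \<longleftrightarrow>
    (\<exists>r. ev (pr 6 (pr a b)) (pr x n) r \<and> ev b (pr x (pr n r)) y)"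
  by (subst ev.simps) simp

lemma ev_mu_iff: "ev (pr 7 a) x y \<longleftrightarrow> ev (pr 8 a) (pr x 0) y"
  by (subst ev.simps) simp

text \<open>The search is unfolded one step at a time: by induction on the derivation in one
  direction, from \<open>y\<close> down to \<open>n\<close> in the other.\<close>

lemma ev_search_iff:
  "ev (pr 8 a) (pr x n) y \<longleftrightarrow>
    n \<le> y \<and> ev a (pr x y) 0 \<and> (\<forall>k. n \<le> k \<longrightarrow> k < y \<longrightarrow> (\<exists>r. ev a (pr x k) (Suc r)))"
  (is "_ \<longleftrightarrow> ?R n")
proof
  assume "ev (pr 8 a) (pr x n) y"
  then show "?R n"
  proof (induction "pr 8 a" "pr x n" y arbitrary: n rule: ev.induct)
    case (ev_next r y)
    then show ?case by simp (metis Suc_leD Suc_leI le_neq_implies_less)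
  qed auto
next
  assume R: "?R n"
  then have "n \<le> y" by simp
  from this R show "ev (pr 8 a) (pr x n) y"
  proof (induction n rule: inc_induct)
    case base
    then show ?case by (simp add: ev_found)
  next
    case (step n)
    then obtain r where "ev a (pr x n) (Suc r)" by auto
    with step show ?case by (auto intro: ev_next)
  qed
qed

lemma partial_computable_ev:
  "partial_computable f \<Longrightarrow> \<exists>e. \<forall>x y. f x = Some y \<longleftrightarrow> ev e x y"
proof (induction rule: partial_computable.induct)
  case zero
  show ?case by (rule exI[of _ "pr 0 0"]) (auto simp: ev_zero_iff)
next
  case succ
  show ?case by (rule exI[of _ "pr 1 0"]) (auto simp: ev_succ_iff[unfolded One_nat_def])
next
  case left
  show ?case by (rule exI[of _ "pr 2 0"]) (auto simp: ev_left_iff)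
next
  case right
  show ?case by (rule exI[of _ "pr 3 0"]) (auto simp: ev_right_iff)
next
  case (pair f g)
  then obtain a b where "\<forall>x y. f x = Some y \<longleftrightarrow> ev a x y" "\<forall>x y. g x = Some y \<longleftrightarrow> ev b x y" by blast
  then show ?case
    by (intro exI[of _ "pr 4 (pr a b)"]) (auto simp: ev_pair_iff bind_eq_Some_conv)
next
  case (comp f g)
  then obtain a b where "\<forall>x y. f x = Some y \<longleftrightarrow> ev a x y" "\<forall>x y. g x = Some y \<longleftrightarrow> ev b x y" by blast
  then show ?case
    by (intro exI[of _ "pr 5 (pr a b)"]) (auto simp: ev_comp_iff bind_eq_Some_conv)
next
  case (prec f g)
  then obtain a b where *: "\<forall>x y. f x = Some y \<longleftrightarrow> ev a x y" "\<forall>x y. g x = Some y \<longleftrightarrow> ev b x y" by blast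
  have "prim_rec f g x n = Some y \<longleftrightarrow> ev (pr 6 (pr a b)) (pr x n) y" for x n y
    by (induction n arbitrary: y) (simp_all add: * ev_prec_0_iff ev_prec_Suc_iff bind_eq_Some_conv)
  from this[of "p1 _" "p2 _"] show ?case
    by (intro exI[of _ "pr 6 (pr a b)"]) simp
next
  case (mu f)
  then obtain a where *: "\<And>x y. f x = Some y \<longleftrightarrow> ev a x y" by blast
  have "mu_search f x = Some y \<longleftrightarrow>
      f (pr x y) = Some 0 \<and> (\<forall>k<y. \<exists>r. f (pr x k) = Some (Suc r))" for x y
  proof -
    have "(LEAST n. f (pr x n) = Some 0) = y"
      if "f (pr x y) = Some 0" "\<forall>k<y. \<exists>r. f (pr x k) = Some (Suc r)" for y
      using that by (intro Least_equality) (auto, metis leI nat.distinct(1) option.inject)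
    then show ?thesis by (auto simp: mu_search_def)
  qed
  then show ?case
    by (intro exI[of _ "pr 7 a"]) (simp add: ev_mu_iff ev_search_iff *)
qed

text \<open>Judgements are stored shifted by one, so that \<open>0\<close> means that nothing is derived.\<close>

abbreviation judg :: "nat \<Rightarrow> nat \<Rightarrow> nat \<Rightarrow> nat" where
  "judg c x y \<equiv> Suc (pr c (pr x y))"

text \<open>The intermediate value of a rule, such as the inner value of a composition, is read off
  its first premise; checking a rule then needs no search.\<close>

definition res :: "nat \<Rightarrow> nat" where "res P = p2 (p2 (P - 1))"

lemma res_judg [simp]: "res (judg c x y) = y"
  by (simp add: res_def)

text \<open>Each disjunct mirrors one rule of \<open>ev\<close>, with \<open>pr g a\<close> as the
  program of the conclusion and \<open>P\<close>, \<open>Q\<close> as the shifted premises.\<close>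

definition rule_app :: "nat \<Rightarrow> nat \<Rightarrow> nat \<Rightarrow> nat \<Rightarrow> nat \<Rightarrow> nat \<Rightarrow> bool" where
  "rule_app g a x y P Q \<longleftrightarrow>
    g = 0 \<and> y = 0 \<or> g = 1 \<and> y = Suc x \<or> g = 2 \<and> y = p1 x \<or> g = 3 \<and> y = p2 x \<or>
    g = 4 \<and> P = judg (p1 a) x (p1 y) \<and> Q = judg (p2 a) x (p2 y) \<or>
    g = 5 \<and> P = judg (p2 a) x (res P) \<and> Q = judg (p1 a) (res P) y \<or>
    g = 6 \<and> p2 x = 0 \<and> P = judg (p1 a) (p1 x) y \<or>
    g = 6 \<and> 0 < p2 x \<and> P = judg (pr 6 a) (pr (p1 x) (p2 x - 1)) (res P) \<and>
      Q = judg (p2 a) (pr (p1 x) (pr (p2 x - 1) (res P))) y \<or>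
    g = 7 \<and> P = judg (pr 8 a) (pr x 0) y \<or>
    g = 8 \<and> P = judg a x 0 \<and> y = p2 x \<or>
    g = 8 \<and> P = judg a x (res P) \<and> 0 < res P \<and> Q = judg (pr 8 a) (pr (p1 x) (Suc (p2 x))) y"

lemma decidable_rule_app [computable_intros]:
  assumes "computable g" "computable a" "computable x" "computable y" "computable P" "computable Q"
  shows "decidable (\<lambda>z. rule_app (g z) (a z) (x z) (y z) (P z) (Q z))"
  unfolding rule_app_def res_def by (intro computable_intros assms)

definition derived :: "nat \<Rightarrow> bool" where
  "derived P \<longleftrightarrow> (\<exists>c x y. P = judg c x y \<and> ev c x y)"

lemma derived_judg [simp]: "derived (judg c x y) \<longleftrightarrow> ev c x y"
  by (simp add: derived_def)

text \<open>A premise slot may hold \<open>0\<close>, for nothing derived. This is harmless because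
  every disjunct that uses a premise equates it with a successor.\<close>

lemma rule_app_sound:
  assumes "rule_app g a x y P Q" "P = 0 \<or> derived P" "Q = 0 \<or> derived Q"
  shows "ev (pr g a) x y"
proof -
  obtain z n where x: "x = pr z n" by (metis prod.collapse prod_decode_inverse)
  have d: "ev c' x' y'" if "P = judg c' x' y'" for c' x' y'
    using assms(2) that by auto
  have d': "ev c' x' y'" if "Q = judg c' x' y'" for c' x' y'
    using assms(3) that by auto
  show ?thesis
    using assms(1) unfolding rule_app_def
  proof (elim disjE conjE, goal_cases)
    case 5
    then show ?case using ev_pair[OF d d', of "p1 a" x "p1 y" "p2 a" "p2 y"] by simp
  next
    case 6
    then show ?case using ev_comp[OF d d', of "p2 a" x "res P" "p1 a" y] by simp
  next
    case 7
    then show ?case using ev_prec_0[OF d[OF 7(3)], of "p2 a"] by (simp add: x)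
  next
    case 8
    then obtain m where "n = Suc m" by (auto simp: x gr0_conv_Suc)
    with 8 show ?case using d[OF 8(3)] d'[OF 8(4)] ev_prec_Suc[of "p1 a" "p2 a" z m "res P" y]
      by (simp add: x)
  next
    case 9
    then show ?case using ev_mu[OF d[OF 9(2)]] by simp
  next
    case 10
    then show ?case using ev_found[of a z n] d[OF 10(2)] by (simp add: x)
  next
    case 11
    then obtain r where r: "res P = Suc r" by (auto simp: gr0_conv_Suc)
    then show ?case using ev_next[of a z n r y] 11(1) d[OF 11(2)] d'[OF 11(4)] by (simp add: x)
  qed (metis ev_zero ev_succ ev_left ev_right)+
qed

text \<open>Stage numbers run through all candidate proof steps: a judgement and the indices of two
  earlier stages as premises. A correct step outputs its judgement, any other step outputs
  \<open>0\<close>.\<close>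

theorem universal_enumeration:
  obtains G where "computable G"
    and "\<And>f. partial_computable f \<Longrightarrow> \<exists>e. \<forall>x y. f x = Some y \<longleftrightarrow> (\<exists>d. G d = Suc (pr e (pr x y)))"
proof -
  \<comment> \<open>Indices not below \<open>s\<close> read as \<open>0\<close>, which makes
    \<open>step\<close> local.\<close>
  define get where "get w s i = (if i < s then w i else 0)" for w :: "nat \<Rightarrow> nat" and s i :: nat
  define step where "step w s = (let t = p1 (p1 s) in
      if rule_app (p1 (p1 t)) (p2 (p1 t)) (p1 (p2 t)) (p2 (p2 t))
        (get w s (p1 (p2 s))) (get w s (p2 (p2 s)))
      then Suc t else 0)" for w s
  obtain v where v: "computable v" "\<And>s. v s = step v s"
  proof (rule course_of_values[of step])
    show "step w s = step w' s" if "\<And>j. j < s \<Longrightarrow> w j = w' j" for w w' s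
      using that by (simp add: step_def get_def)
  next
    fix W assume W: "computable (\<lambda>p. W (p1 p) (p2 p))"
    have W': "computable (\<lambda>x. W (f x) (g x))" if "computable f" "computable g" for f g
      using computable_comp[OF W computable_pair[OF that]] by simp
    show "computable (\<lambda>x. step (W x) (p2 x))"
      unfolding step_def get_def Let_def by (intro computable_intros W')
  qed blast
  have sound: "v s = 0 \<or> derived (v s)" for s
  proof (induction s rule: less_induct)
    case (less s)
    define t where "t = p1 (p1 s)"
    have "get v s i = 0 \<or> derived (get v s i)" for i using less by (simp add: get_def)
    then have "rule_app (p1 (p1 t)) (p2 (p1 t)) (p1 (p2 t)) (p2 (p2 t))
        (get v s (p1 (p2 s))) (get v s (p2 (p2 s))) \<Longrightarrow> ev (p1 t) (p1 (p2 t)) (p2 (p2 t))"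
      using rule_app_sound[of "p1 (p1 t)" "p2 (p1 t)"] by simp
    moreover have "derived (Suc t) \<longleftrightarrow> ev (p1 t) (p1 (p2 t)) (p2 (p2 t))"
      using derived_judg[of "p1 t" "p1 (p2 t)" "p2 (p2 t)"] by (simp del: derived_judg)
    ultimately show ?case unfolding v(2)[of s] step_def Let_def t_def[symmetric] by auto
  qed
  have produce: "\<exists>s. v s = judg (pr g a) x y" if "rule_app g a x y (v i) (v j)" for g a x y i j
  proof -
    \<comment> \<open>The component \<open>Suc (i + j)\<close> is padding that forces both premise
      indices below \<open>s\<close>.\<close>
    define s where "s = pr (pr (pr (pr g a) (pr x y)) (Suc (i + j))) (pr i j)"
    have "Suc (i + j) \<le> s"
      unfolding s_def by (meson le_prod_encode_1 le_prod_encode_2 order_trans)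
    then have "i < s" "j < s" by simp_all
    moreover have "p1 (p1 s) = pr (pr g a) (pr x y)" "p1 (p2 s) = i" "p2 (p2 s) = j"
      by (simp_all add: s_def)
    ultimately have "v s = judg (pr g a) x y"
      using that by (subst v(2)) (simp add: step_def get_def)
    then show ?thesis by blast
  qed
  have complete: "\<exists>s. v s = judg c x y" if "ev c x y" for c x y
    using that
  proof (induction rule: ev.induct)
    case (ev_pair a x u b w)
    then obtain i j where "v i = judg a x u" "v j = judg b x w" by blast
    then show ?case by (intro produce[of _ _ _ _ i j]) (simp add: rule_app_def)
  next
    case (ev_comp b x u a y)
    then obtain i j where "v i = judg b x u" "v j = judg a u y" by blast
    then show ?case by (intro produce[of _ _ _ _ i j]) (simp add: rule_app_def)
  next
    case (ev_prec_0 a x y b)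
    then obtain i where "v i = judg a x y" by blast
    then show ?case by (intro produce[of _ _ _ _ i i]) (simp add: rule_app_def)
  next
    case (ev_prec_Suc a b x n r y)
    then obtain i j where "v i = judg (pr 6 (pr a b)) (pr x n) r" "v j = judg b (pr x (pr n r)) y" by blast
    then show ?case by (intro produce[of _ _ _ _ i j]) (simp add: rule_app_def)
  next
    case (ev_mu a x y)
    then obtain i where "v i = judg (pr 8 a) (pr x 0) y" by blast
    then show ?case by (intro produce[of _ _ _ _ i i]) (simp add: rule_app_def)
  next
    case (ev_found a x n)
    then obtain i where "v i = judg a (pr x n) 0" by blast
    then show ?case by (intro produce[of _ _ _ _ i i]) (simp add: rule_app_def)
  next
    case (ev_next a x n r y)
    then obtain i j where "v i = judg a (pr x n) (Suc r)" "v j = judg (pr 8 a) (pr x (Suc n)) y" by blast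
    then show ?case by (intro produce[of _ _ _ _ i j]) (simp add: rule_app_def)
  qed (intro produce[of _ _ _ _ 0 0]; simp add: rule_app_def)+
  have "ev c x y \<longleftrightarrow> (\<exists>s. v s = judg c x y)" for c x y
    using sound complete by (metis derived_judg nat.distinct(1))
  with partial_computable_ev show ?thesis
    by (intro that[of v]) (auto simp: v(1))
qed

section \<open>Collapsing representatives along a stagewise construction\<close>

text \<open>\<open>k s = Suc e\<close> means that requirement \<open>e\<close> acts at stage \<open>s\<close>; it then discards the
  columns assigned to all \<open>i > e\<close>.  The column of \<open>A i\<close> at stage \<open>s\<close> consists of the numbers
  \<open>cell i (marker k s i) x\<close>.\<close>

primrec marker :: "(nat \<Rightarrow> nat) \<Rightarrow> nat \<Rightarrow> nat \<Rightarrow> nat" where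
  "marker k 0 i = 0"
| "marker k (Suc s) i = (if 0 < k s \<and> k s \<le> i then Suc s else marker k s i)"

text \<open>The flag is withdrawn when a stronger requirement acts: because of the shift in
  \<open>k\<close>, \<open>k s \<le> e\<close> means that the acting number is less than
  \<open>e\<close>.\<close>

primrec satisfied :: "(nat \<Rightarrow> nat) \<Rightarrow> nat \<Rightarrow> nat \<Rightarrow> bool" where
  "satisfied k 0 e \<longleftrightarrow> False"
| "satisfied k (Suc s) e \<longleftrightarrow> k s = Suc e \<or> \<not> (0 < k s \<and> k s \<le> e) \<and> satisfied k s e"

text \<open>Stage \<open>s\<close> redirects the class represented by \<open>P s\<close> to
  \<open>Q s\<close>; \<open>P s = Q s\<close> means that nothing is collapsed.\<close>

primrec rep :: "(nat \<Rightarrow> nat) \<Rightarrow> (nat \<Rightarrow> nat) \<Rightarrow> nat \<Rightarrow> nat \<Rightarrow> nat" where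
  "rep P Q 0 x = x"
| "rep P Q (Suc s) x = (if rep P Q s x = P s then Q s else rep P Q s x)"

abbreviation cell :: "nat \<Rightarrow> nat \<Rightarrow> nat \<Rightarrow> nat" where "cell i t x \<equiv> pr (pr i t) x"
abbreviation ix :: "nat \<Rightarrow> nat" where "ix p \<equiv> p1 (p1 p)"
abbreviation tm :: "nat \<Rightarrow> nat" where "tm p \<equiv> p2 (p1 p)"

text \<open>These are the current columns that requirement \<open>e\<close> must respect; the
  predicate is applied to representatives.\<close>

definition prot :: "(nat \<Rightarrow> nat) \<Rightarrow> nat \<Rightarrow> nat \<Rightarrow> nat \<Rightarrow> bool" where
  "prot k s e p \<longleftrightarrow> ix p \<le> e \<and> tm p = marker k s (ix p)"

text \<open>At a calm stage any acting requirement has number above \<open>e\<close>. It moves only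
  columns beyond \<open>Suc e\<close>, so the marker of column \<open>Suc e\<close> is kept as
  well.\<close>

definition calm :: "(nat \<Rightarrow> nat) \<Rightarrow> nat \<Rightarrow> nat \<Rightarrow> bool" where
  "calm k e s \<longleftrightarrow> k s = 0 \<or> Suc e < k s"

section \<open>Finite injury: markers and satisfaction flags\<close>

lemma marker_le: "marker k s i \<le> s"
  by (induction s) (auto simp: le_SucI)

text \<open>An action moves a final segment of the columns, and its new marker exceeds all earlier
  ones.\<close>

lemma marker_mono: "i \<le> j \<Longrightarrow> marker k s i \<le> marker k s j"
  by (induction s) (auto simp: le_SucI marker_le)

lemma marker_calm:
  assumes "s \<le> t" "\<And>j. s \<le> j \<Longrightarrow> j < t \<Longrightarrow> calm k e j" "i \<le> Suc e"
  shows "marker k t i = marker k s i"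
  using assms(1,2)
proof (induction t rule: dec_induct)
  case (step t)
  then have "marker k t i = marker k s i" "calm k e t" by auto
  with assms(3) show ?case by (auto simp: calm_def)
qed simp

text \<open>The last action of \<open>e\<close> is the one wanted: an action of a smaller number
  after it would have withdrawn the flag.\<close>

lemma satisfied_obtain:
  assumes "satisfied k s e"
  obtains j where "j < s" "k j = Suc e" "\<And>l. j < l \<Longrightarrow> l < s \<Longrightarrow> calm k e l"
proof -
  have "\<exists>j<s. k j = Suc e \<and> (\<forall>l. j < l \<longrightarrow> l < s \<longrightarrow> calm k e l)"
    using assms
  proof (induction s)
    case (Suc s)
    show ?case
    proof (cases "k s = Suc e")
      case False
      with Suc obtain j where "j < s" "k j = Suc e" "\<forall>l. j < l \<longrightarrow> l < s \<longrightarrow> calm k e l" by auto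
      moreover have "calm k e s" using Suc.prems False by (auto simp: calm_def)
      ultimately show ?thesis by (metis less_Suc_eq)
    qed auto
  qed simp
  then show ?thesis using that by blast
qed

lemma satisfied_mono:
  assumes "satisfied k s e" "s \<le> t" "\<And>j. s \<le> j \<Longrightarrow> j < t \<Longrightarrow> k j = 0 \<or> e < k j"
  shows "satisfied k t e"
  using assms(2,1,3)
proof (induction t rule: dec_induct)
  case (step t)
  then have "satisfied k t e" "k t = 0 \<or> e < k t" by auto
  then show ?case by auto
qed simp

text \<open>Once all stronger requirements have stopped, a requirement acts at most once more, since
  it then stays satisfied.\<close>

lemma eventually_calm:
  assumes "\<And>s e. k s = Suc e \<Longrightarrow> \<not> satisfied k s e"
  obtains s where "\<And>j. s \<le> j \<Longrightarrow> calm k e j"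
proof -
  have "\<exists>s. \<forall>j\<ge>s. k j = 0 \<or> n < k j" for n
  proof (induction n)
    case (Suc n)
    then obtain s where s: "\<forall>j\<ge>s. k j = 0 \<or> n < k j" by blast
    show ?case
    proof (cases "\<exists>j\<ge>s. k j = Suc n")
      case True
      then obtain j where j: "j \<ge> s" "k j = Suc n" by blast
      have "satisfied k t n" if "Suc j \<le> t" for t
        by (rule satisfied_mono[of k "Suc j"]) (use that s j in auto)
      with assms s j have "\<forall>t\<ge>Suc j. k t = 0 \<or> Suc n < k t"
        by (metis Suc_leD Suc_lessI order_trans)
      then show ?thesis by blast
    next
      case False
      with s show ?thesis by (metis Suc_lessI)
    qed
  qed auto
  from this[of "Suc e"] show ?thesis using that by (auto simp: calm_def)
qed

lemma uniform_join_iff: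
  "(x, y) \<in> uniform_join (n + 1) B \<longleftrightarrow>
    x mod (n + 1) = y mod (n + 1) \<and> (x div (n + 1), y div (n + 1)) \<in> B (x mod (n + 1))"
proof -
  have "(z - z mod m) div m = z div m" if "0 < m" for z m :: nat
    using that by (simp add: minus_mod_eq_mult_div)
  from this[of "n + 1"] have "(z - z mod (n + 1)) div (n + 1) = z div (n + 1)" for z by simp
  then show ?thesis
    by (auto simp: uniform_join_def simp del: Suc_eq_plus1) (metis mod_less_divisor zero_less_Suc Suc_eq_plus1)
qed

text \<open>The locale is instantiated for \<open>X\<close> without and for \<open>Y\<close> with restraint: inequivalences
  have to be preserved in \<open>Y\<close> only, and \<open>marker k s e\<close> exceeds all numbers used by requirements
  \<open>e' < e\<close> when they last acted.\<close>

locale collapse =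
  fixes A :: "nat \<Rightarrow> nat rel" and k P Q :: "nat \<Rightarrow> nat" and restrained :: bool
  assumes equiv_A: "equiv UNIV (A i)"
    and rep_computable: "computable (\<lambda>p. rep P Q (p1 p) (p2 p))"
    and act_unsatisfied: "k s = Suc e \<Longrightarrow> \<not> satisfied k s e"
    and P_le: "P s \<le> s" and Q_le: "Q s \<le> s"
    and coding_step: "k s = 0 \<Longrightarrow> P s \<noteq> Q s \<Longrightarrow> \<exists>i x y. (x, y) \<in> A i \<and>
      P s = rep P Q s (cell i (marker k s i) x) \<and> Q s = rep P Q s (cell i (marker k s i) y)"
    and action_step: "k s = Suc e \<Longrightarrow> P s \<noteq> Q s \<Longrightarrow>
      (\<exists>a. P s = rep P Q s a) \<and> (\<exists>a. Q s = rep P Q s a) \<and>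
      \<not> prot k s e (P s) \<and> (restrained \<longrightarrow> marker k s e \<le> P s)"
    and coding_complete: "(x, y) \<in> A i \<Longrightarrow> (\<And>s. n \<le> s \<Longrightarrow> marker k s i = m) \<Longrightarrow>
      \<exists>s\<ge>n. P s = rep P Q s (cell i m x) \<and> Q s = rep P Q s (cell i m y)"
begin

section \<open>Representatives and the limit relation\<close>

abbreviation h :: "nat \<Rightarrow> nat \<Rightarrow> nat" where "h \<equiv> rep P Q"

definition limit_rel :: "nat rel" where
  "limit_rel = {(x, y). \<exists>s. h s x = h s y}"

text \<open>Collapses before stage \<open>s\<close> only involve numbers below
  \<open>s\<close>.\<close>

lemma rep_fresh: "s \<le> x \<Longrightarrow> h s y = x \<longleftrightarrow> y = x"
proof (induction s)
  case (Suc s)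
  then have "h s y = x \<longleftrightarrow> y = x" by simp
  with Suc.prems P_le[of s] Q_le[of s] show ?case by auto
qed simp

lemma rep_less: "x < s \<Longrightarrow> h s x < s"
  using rep_fresh[of s "h s x" x] by (metis leD leI)

text \<open>Both numbers of a nontrivial collapse are themselves current representatives.\<close>

lemma rep_idem: "h s (h s x) = h s x"
proof (induction s arbitrary: x)
  case (Suc s)
  have "h s (P s) = P s \<and> h s (Q s) = Q s" if "P s \<noteq> Q s"
    using coding_step[OF _ that] action_step[OF _ that] Suc.IH
    by (cases "k s") auto
  with Suc show ?case by (cases "P s = Q s") auto
qed simp

lemma rep_eq_mono: "h s x = h s y \<Longrightarrow> s \<le> t \<Longrightarrow> h t x = h t y"
  by (rule dec_induct[of s t]) auto

lemma equiv_limit_rel: "equiv UNIV limit_rel"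
proof (rule equivI)
  show "sym limit_rel" unfolding limit_rel_def sym_def by (auto intro: sym)
  show "trans limit_rel"
  proof (rule transI)
    fix x y z assume "(x, y) \<in> limit_rel" "(y, z) \<in> limit_rel"
    then obtain s t where "h s x = h s y" "h t y = h t z" by (auto simp: limit_rel_def)
    then have "h (max s t) x = h (max s t) z"
      using rep_eq_mono[of s x y "max s t"] rep_eq_mono[of t y z "max s t"] by simp
    then show "(x, z) \<in> limit_rel" by (auto simp: limit_rel_def)
  qed
qed (auto simp: limit_rel_def refl_on_def)

lemma ceer_limit_rel: "ceer limit_rel"
proof -
  have rep_comp: "computable (\<lambda>x. h (f x) (g x))" if "computable f" "computable g" for f g
    using computable_comp[OF rep_computable computable_pair[OF that]] by simp
  have "prod_encode ` limit_rel = {w. \<exists>s. h s (p1 w) = h s (p2 w)}"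
    by (force simp: limit_rel_def image_iff)
  moreover have "ce {w. \<exists>s. h s (p1 w) = h s (p2 w)}"
    by (rule ce_ex) (intro computable_intros rep_comp)
  ultimately show ?thesis by (simp add: ceer_def equiv_limit_rel)
qed

section \<open>Faithful copies in the current columns\<close>

definition active :: "nat \<Rightarrow> nat \<Rightarrow> nat \<Rightarrow> bool" where
  "active s i p \<longleftrightarrow> ix p = i \<and> tm p = marker k s i"

lemma prot_iff_active: "prot k s e p \<longleftrightarrow> ix p \<le> e \<and> active s (ix p) p"
  by (simp add: prot_def active_def)

lemma active_cell [simp]: "active s i (cell i (marker k s i) x)"
  by (simp add: active_def)

lemma tm_le: "tm p \<le> p"
  by (metis le_prod_encode_1 le_prod_encode_2 order_trans prod.collapse prod_decode_inverse)

text \<open>Elements of a column just moved are at least its marker \<open>Suc s\<close>, so no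
  collapse has touched them yet.\<close>

lemma active_Suc_new:
  assumes "active (Suc s) i x" "0 < k s" "k s \<le> i"
  shows "h (Suc s) y = x \<longleftrightarrow> y = x"
  using assms tm_le[of x] by (intro rep_fresh) (simp add: active_def)

lemma active_Suc_old: "\<not> (0 < k s \<and> k s \<le> i) \<Longrightarrow> active (Suc s) i x \<longleftrightarrow> active s i x"
  by (auto simp: active_def)

text \<open>Coding collapses stay inside one column, and an action never redirects a protected
  representative; the columns it does not protect are abandoned and restart afresh.\<close>

lemma active_rep: "active s i x \<Longrightarrow> active s i (h s x)"
proof (induction s arbitrary: i x)
  case (Suc s)
  show ?case
  proof (cases "0 < k s \<and> k s \<le> i")
    case True
    then show ?thesis using Suc.prems active_Suc_new by metis
  next
    case False
    note old = active_Suc_old[OF False]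
    from Suc.prems have x: "active s i x" by (simp add: old)
    then have hx: "active s i (h s x)" by (rule Suc.IH)
    have "active s i (Q s)" if "h s x = P s" "P s \<noteq> Q s"
    proof (cases "k s")
      case 0
      from coding_step[OF 0 that(2)] obtain j y z where
        "P s = h s (cell j (marker k s j) y)" "Q s = h s (cell j (marker k s j) z)" by blast
      then have "active s j (P s)" "active s j (Q s)" using Suc.IH active_cell by metis+
      with hx that(1) show ?thesis by (auto simp: active_def)
    next
      case (Suc e)
      with False have "i \<le> e" by simp
      with hx that(1) have "prot k s e (P s)" by (auto simp: prot_iff_active active_def)
      with action_step[OF Suc that(2)] show ?thesis by blast
    qed
    with hx show ?thesis unfolding old by (cases "P s = Q s") auto
  qed
qed simp

text \<open>Only coding can merge classes of a current column, and each such merge comes from a pair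
  in \<open>A i\<close>; transitivity accounts for chains of merges.\<close>

lemma active_faithful:
  "active s i x \<Longrightarrow> active s i y \<Longrightarrow> h s x = h s y \<Longrightarrow> (p2 x, p2 y) \<in> A i"
proof (induction s arbitrary: x y)
  case 0
  then show ?case using equiv_A[of i] by (simp add: equiv_def refl_on_def)
next
  case (Suc s)
  note eq = equiv_A[of i, unfolded equiv_def]
  show ?case
  proof (cases "0 < k s \<and> k s \<le> i")
    case True
    then have "x = y" using Suc.prems active_Suc_new by metis
    then show ?thesis using eq by (simp add: refl_on_def)
  next
    case False
    note old = active_Suc_old[OF False]
    from Suc.prems have xy: "active s i x" "active s i y" by (simp_all add: old)
    \<comment> \<open>The case where this stage redirects the class of \<open>x\<close> to that of
      \<open>y\<close>; the opposite case follows by symmetry.\<close>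
    have main: "(p2 x, p2 y) \<in> A i"
      if xy: "active s i x" "active s i y" and PQ: "h s x = P s" "h s y = Q s" "P s \<noteq> Q s" for x y
    proof (cases "k s")
      case 0
      from coding_step[OF 0 PQ(3)] obtain j u w where
        *: "(u, w) \<in> A j" "P s = h s (cell j (marker k s j) u)" "Q s = h s (cell j (marker k s j) w)"
        by blast
      have "active s j (P s)" using * active_rep active_cell by metis
      moreover have "active s i (P s)" using xy(1) active_rep PQ(1) by metis
      ultimately have j: "j = i" by (simp add: active_def)
      have "(p2 x, u) \<in> A i"
        using Suc.IH[OF xy(1), of "cell i (marker k s i) u"] * PQ j by simp
      moreover have "(w, p2 y) \<in> A i"
        using Suc.IH[OF _ xy(2), of "cell i (marker k s i) w"] * PQ j by simp
      ultimately show ?thesis using eq * j by (meson transE)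
    next
      case (Suc e)
      with False have "i \<le> e" by simp
      moreover have "active s i (P s)" using xy(1) active_rep PQ(1) by metis
      ultimately have "prot k s e (P s)" by (auto simp: prot_iff_active active_def)
      with action_step[OF Suc PQ(3)] show ?thesis by blast
    qed
    show ?thesis
    proof (cases "h s x = h s y")
      case True
      then show ?thesis using Suc.IH xy by blast
    next
      case False
      with Suc.prems(3) have "h s x = P s \<and> h s y = Q s \<or> h s y = P s \<and> h s x = Q s"
        by (auto split: if_splits)
      with False main[OF xy] main[OF xy(2,1)] show ?thesis using eq by (auto dest: symD)
    qed
  qed
qed

section \<open>Persistence through calm stages\<close>

lemma calm_step:
  assumes "calm k e s" "P s \<noteq> Q s"
  shows "(\<exists>i\<le>e. active s i (P s) \<and> active s i (Q s)) \<or>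
    \<not> prot k s e (P s) \<and> (restrained \<longrightarrow> marker k s (Suc e) \<le> P s)"
\<comment> \<open>Coding beyond column \<open>e\<close> redirects a number at least as large as its
  column's marker; for actions the lower bound is the restraint. Monotonicity of markers reduces
  both bounds to column \<open>Suc e\<close>.\<close>
proof (cases "k s")
  case 0
  from coding_step[OF 0 assms(2)] obtain i x y where
    "P s = h s (cell i (marker k s i) x)" "Q s = h s (cell i (marker k s i) y)" by blast
  then have a: "active s i (P s)" "active s i (Q s)" using active_rep active_cell by metis+
  show ?thesis
  proof (cases "i \<le> e")
    case False
    then have "marker k s (Suc e) \<le> marker k s i" by (intro marker_mono) simp
    also have "\<dots> \<le> P s" using a(1) tm_le[of "P s"] by (simp add: active_def)
    finally show ?thesis using a(1) False by (auto simp: active_def prot_def)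
  qed (use a in blast)
next
  case (Suc e')
  with assms(1) have "Suc e \<le> e'" by (simp add: calm_def)
  then have "marker k s (Suc e) \<le> marker k s e'" by (rule marker_mono)
  then show ?thesis using action_step[OF Suc assms(2)] \<open>Suc e \<le> e'\<close> by (auto simp: prot_def)
qed

lemma calm_active_Suc: "calm k e s \<Longrightarrow> i \<le> Suc e \<Longrightarrow> active (Suc s) i p \<longleftrightarrow> active s i p"
  by (rule active_Suc_old) (auto simp: calm_def)

lemma calm_prot_Suc: "calm k e s \<Longrightarrow> prot k (Suc s) e p \<longleftrightarrow> prot k s e p"
  by (auto simp: prot_iff_active calm_active_Suc)

text \<open>In contrast to \<open>active_rep\<close>, \<open>x\<close> itself may lie outside the
  column: once its representative has entered, calm stages keep it there.\<close>

lemma active_rep_Suc: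
  assumes "calm k e s" "i \<le> e" "active s i (h s x)"
  shows "active (Suc s) i (h (Suc s) x)"
proof -
  have "active s i (h (Suc s) x)"
    using calm_step[OF assms(1)] assms(2,3)
    by (cases "P s = Q s") (auto simp: prot_iff_active active_def)
  then show ?thesis using assms by (simp add: calm_active_Suc)
qed

lemma active_rep_mono:
  assumes "s \<le> t" "\<And>j. s \<le> j \<Longrightarrow> j < t \<Longrightarrow> calm k e j" "i \<le> e" "active s i (h s x)"
  shows "active t i (h t x)"
  using assms(1,2)
proof (induction t rule: dec_induct)
  case (step t)
  then show ?case by (intro active_rep_Suc[OF _ assms(3)]) auto
qed (rule assms(4))

lemma prot_rep_mono:
  assumes "s \<le> t" "\<And>j. s \<le> j \<Longrightarrow> j < t \<Longrightarrow> calm k e j" "prot k s e (h s x)"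
  shows "prot k t e (h t x)"
proof -
  have "active t (ix (h s x)) (h t x)"
    by (rule active_rep_mono[OF assms(1,2)]) (use assms(3) in \<open>auto simp: prot_iff_active\<close>)
  then show ?thesis using assms(3) by (simp add: prot_iff_active active_def)
qed

text \<open>Below the marker of column \<open>Suc e\<close>, neither alternative of
  \<open>calm_step\<close> can redirect an unprotected representative.\<close>

lemma small_rep_mono:
  assumes "s \<le> t" "\<And>j. s \<le> j \<Longrightarrow> j < t \<Longrightarrow> calm k e j" "restrained" "h s x < marker k s (Suc e)"
  shows "prot k t e (h t x) \<or> h t x = h s x"
  using assms(1,2)
proof (induction t rule: dec_induct)
  case (step t)
  then have c: "calm k e t" by simp
  have m: "marker k t (Suc e) = marker k s (Suc e)"
    by (rule marker_calm) (use step in auto)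
  have "prot k t e (h t x) \<or> h t x = h s x" using step by simp
  then consider "prot k t e (h t x)" | "h t x = h s x" "\<not> prot k t e (h t x)" by blast
  then show ?case
  proof cases
    case 1
    have "prot k (Suc t) e (h (Suc t) x)"
      by (rule prot_rep_mono[of t]) (use 1 c le_antisym in fastforce)+
    then show ?thesis ..
  next
    case 2
    have "h t x \<noteq> P t \<or> P t = Q t"
      using calm_step[OF c] 2 assms(3,4) m
      by (cases "P t = Q t") (auto simp: prot_iff_active active_def)
    then show ?thesis using 2 by auto
  qed
qed simp

text \<open>The invariant also keeps each representative protected or at most \<open>j\<close>.
  Collapses inside a protected column cannot merge the two, as they never share one; all other
  collapses redirect unprotected numbers above \<open>j\<close>.\<close>

lemma separation_preserved:
  assumes act: "k j = Suc e" and calm: "\<And>l. j < l \<Longrightarrow> l < t \<Longrightarrow> calm k e l" and "j < t"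
    and PQ: "P j = Q j" and r: restrained and ab: "a \<le> j" "b \<le> j"
    and sep: "h j a \<noteq> h j b" "\<not> (prot k j e (h j a) \<and> prot k j e (h j b) \<and> ix (h j a) = ix (h j b))"
  shows "h t a \<noteq> h t b"
proof -
  have "Suc j \<le> t" using \<open>j < t\<close> by simp
  then have "h t a \<noteq> h t b \<and>
      \<not> (prot k t e (h t a) \<and> prot k t e (h t b) \<and> ix (h t a) = ix (h t b)) \<and>
      (prot k t e (h t a) \<or> h t a \<le> j) \<and> (prot k t e (h t b) \<or> h t b \<le> j)"
    using calm
  proof (induction t rule: dec_induct)
    case base
    have "h (Suc j) x = h j x" for x using PQ by auto
    moreover have "h (Suc j) a \<le> j" "h (Suc j) b \<le> j"
      using ab rep_less[of a "Suc j"] rep_less[of b "Suc j"]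
      by (simp_all add: less_Suc_eq_le del: rep.simps)
    moreover have "prot k (Suc j) e p \<longleftrightarrow> prot k j e p" for p using act by (auto simp: prot_def)
    ultimately show ?case using sep by simp
  next
    case (step t)
    then have c: "calm k e t" by simp
    have "marker k t (Suc e) = marker k (Suc j) (Suc e)"
      by (rule marker_calm) (use step in auto)
    \<comment> \<open>The action at \<open>j\<close> itself moved column \<open>Suc e\<close> to
      \<open>Suc j\<close>.\<close>
    then have m: "marker k t (Suc e) = Suc j" using act by simp
    show ?case
    proof (cases "P t = Q t")
      case True
      then have "h (Suc t) x = h t x" for x by auto
      then show ?thesis using step by (simp add: calm_prot_Suc[OF c])
    next
      case False
      from calm_step[OF c False] show ?thesis
      proof
        assume "\<exists>i\<le>e. active t i (P t) \<and> active t i (Q t)"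
        then have "prot k t e (P t)" "prot k t e (Q t)" "ix (P t) = ix (Q t)"
          by (auto simp: prot_iff_active active_def)
        with step show ?thesis unfolding calm_prot_Suc[OF c] by auto
      next
        assume "\<not> prot k t e (P t) \<and> (restrained \<longrightarrow> marker k t (Suc e) \<le> P t)"
        with r m have "\<not> prot k t e (P t)" "j < P t" by auto
        with step have "h t a \<noteq> P t" "h t b \<noteq> P t" by auto
        with step show ?thesis unfolding calm_prot_Suc[OF c] by auto
      qed
    qed
  qed
  then show ?thesis by blast
qed

section \<open>Comparison of the limit relation with finite joins\<close>

lemma limit_rel_active:
  assumes calm: "\<And>j. s \<le> j \<Longrightarrow> calm k e j"
    and "i \<le> e" "i' \<le> e" "active s i x" "active s i' y"
  shows "(x, y) \<in> limit_rel \<longleftrightarrow> i = i' \<and> (p2 x, p2 y) \<in> A i"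
proof
  assume "(x, y) \<in> limit_rel"
  then obtain t where t: "h t x = h t y" by (auto simp: limit_rel_def)
  define t' where "t' = max s t"
  have eq: "h t' x = h t' y" using rep_eq_mono[OF t] by (simp add: t'_def)
  have "marker k t' j = marker k s j" if "j \<le> e" for j
    by (rule marker_calm[of s t' k e]) (use that calm in \<open>auto simp: t'_def\<close>)
  then have a: "active t' i x" "active t' i' y" using assms by (auto simp: active_def)
  then have "active t' i (h t' x)" "active t' i' (h t' y)" by (auto intro: active_rep)
  then have "i = i'" using eq by (simp add: active_def)
  with a eq active_faithful show "i = i' \<and> (p2 x, p2 y) \<in> A i" by blast
next
  assume R: "i = i' \<and> (p2 x, p2 y) \<in> A i"
  \<comment> \<open>Column \<open>i\<close> is final, so \<open>coding_complete\<close> copies the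
    pair at some stage.\<close>
  have "marker k t i = marker k s i" if "s \<le> t" for t
    by (rule marker_calm[OF that, of k e]) (use calm assms in auto)
  from coding_complete[OF conjunct2[OF R] this] obtain t where
    "P t = h t (cell i (marker k s i) (p2 x))" "Q t = h t (cell i (marker k s i) (p2 y))" by blast
  moreover have "cell (ix z) (tm z) (p2 z) = z" for z by simp
  then have "cell i (marker k s i) (p2 x) = x" "cell i (marker k s i) (p2 y) = y"
    using assms(4,5) R unfolding active_def by metis+
  ultimately have "h (Suc t) x = h (Suc t) y" by simp
  then show "(x, y) \<in> limit_rel" unfolding limit_rel_def by blast
qed

text \<open>Once requirements up to \<open>n\<close> have stopped, columns \<open>0\<close> to
  \<open>n\<close> are permanent; residue and quotient become column index and position.\<close>

lemma join_reducible: "uniform_join (n + 1) A \<preceq> limit_rel"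
proof -
  obtain s where calm: "\<And>j. s \<le> j \<Longrightarrow> calm k n j"
    using eventually_calm[of k n] act_unsatisfied by blast
  define M where "M i = (if i < Suc n then marker k s i else 0)" for i
  define f where "f x = cell (x mod (n + 1)) (M (x mod (n + 1))) (x div (n + 1))" for x
  have "computable f"
    unfolding f_def M_def
    by (intro computable_intros computable_mod computable_div computable_finite_table) simp_all
  moreover have "(x, y) \<in> uniform_join (n + 1) A \<longleftrightarrow> (f x, f y) \<in> limit_rel" for x y
  proof -
    have le: "x mod (n + 1) \<le> n" for x by (simp add: less_Suc_eq_le[symmetric])
    then have "active s (x mod (n + 1)) (f x)" for x
      by (simp add: active_def f_def M_def less_Suc_eq_le)
    from limit_rel_active[OF calm le le this this, of x y] show ?thesis
      unfolding uniform_join_iff by (simp add: f_def)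
  qed
  ultimately show ?thesis unfolding reducible_def by blast
qed

text \<open>Searching for a stage with a protected representative computes a permanent column and a
  position in it, which are coded as residue and quotient.\<close>

lemma reducible_join:
  assumes f: "computable f" and Z: "\<And>x y. (x, y) \<in> Z \<longleftrightarrow> (f x, f y) \<in> limit_rel"
    and calm: "\<And>j. s \<le> j \<Longrightarrow> calm k e j"
    and enters: "\<And>x. \<exists>t\<ge>s. prot k t e (h t (f x))"
  shows "Z \<preceq> uniform_join (e + 1) A"
proof -
  define M where "M i = (if i < Suc e then marker k s i else 0)" for i
  have M: "marker k t i = M i" if "s \<le> t" "i \<le> e" for t i
    using marker_calm[OF that(1), of k e i] calm that(2) by (auto simp: M_def)
  \<comment> \<open>With the constant table \<open>M\<close> in place of \<open>marker\<close>,
    decidability does not depend on computability of \<open>k\<close>.\<close>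
  define R where "R x t \<longleftrightarrow> s \<le> t \<and> ix (h t (f x)) \<le> e \<and> tm (h t (f x)) = M (ix (h t (f x)))" for x t
  have R_iff: "R x t \<longleftrightarrow> s \<le> t \<and> prot k t e (h t (f x))" for x t
    by (auto simp: R_def prot_def M)
  define g where "g x = (LEAST t. R x t)" for x
  define p where "p x = h (g x) (f x)" for x
  have rep_comp: "computable (\<lambda>x. h (a x) (b x))" if "computable a" "computable b" for a b
    using computable_comp[OF rep_computable computable_pair[OF that]] by simp
  have "computable g"
    unfolding g_def
  proof (rule computable_Least)
    show "decidable (\<lambda>p. R (p1 p) (p2 p))"
      unfolding R_def M_def
      by (intro computable_intros rep_comp computable_comp[OF f] computable_finite_table)
  qed (use enters in \<open>auto simp: R_iff\<close>)
  then have p_comp: "computable p"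
    unfolding p_def by (intro rep_comp f)
  define q where "q x = (e + 1) * p2 (p x) + ix (p x)" for x
  have "computable q" unfolding q_def by (intro computable_intros p_comp)
  moreover have "(x, y) \<in> Z \<longleftrightarrow> (q x, q y) \<in> uniform_join (e + 1) A" for x y
  proof -
    have Rg: "R x (g x)" for x
    proof -
      have "\<exists>t. R x t" using enters[of x] by (auto simp: R_iff)
      then show ?thesis unfolding g_def by (rule LeastI_ex)
    qed
    then have le: "ix (p x) \<le> e" and "tm (p x) = M (ix (p x))" for x
      by (auto simp: R_def p_def)
    then have act: "active s (ix (p x)) (p x)" for x
      using M[of s "ix (p x)"] by (simp add: active_def)
    have "(f x, p x) \<in> limit_rel" for x
      using rep_idem[of "g x" "f x"] by (auto simp: limit_rel_def p_def intro: sym)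
    then have "(f x, f y) \<in> limit_rel \<longleftrightarrow> (p x, p y) \<in> limit_rel"
      using equiv_limit_rel by (meson equiv_def symD transD)
    also have "\<dots> \<longleftrightarrow> ix (p x) = ix (p y) \<and> (p2 (p x), p2 (p y)) \<in> A (ix (p x))"
      by (rule limit_rel_active[OF calm le le act act])
    also have "\<dots> \<longleftrightarrow> (q x, q y) \<in> uniform_join (e + 1) A"
    proof -
      have "(m * a + b) mod m = b" "(m * a + b) div m = a" if "b < m" for m a b :: nat
        using that by simp_all
      from this[of "ix (p _)" "e + 1" "p2 (p _)"]
      have "q z mod (e + 1) = ix (p z)" "q z div (e + 1) = p2 (p z)" for z
        using le[of z] by (simp_all only: q_def less_Suc_eq_le Suc_eq_plus1[symmetric])
      then show ?thesis unfolding uniform_join_iff by simp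
    qed
    finally show ?thesis by (simp add: Z)
  qed
  ultimately show ?thesis unfolding reducible_def by blast
qed

text \<open>If \<open>f x\<close> never becomes protected, restraint freezes its representative
  below the permanent marker of column \<open>Suc e\<close>. By \<open>inj\<close> these
  representatives are distinct, so there are finitely many such \<open>x\<close>; without restraint
  there are none.\<close>

lemma cofinitely_prot:
  fixes f :: "nat \<Rightarrow> nat"
  assumes inj: "\<And>x y. (f x, f y) \<in> limit_rel \<longleftrightarrow> x = y"
    and calm: "\<And>j. s \<le> j \<Longrightarrow> calm k e j"
    and enters: "\<And>x. \<exists>t\<ge>s. prot k t e (h t (f x)) \<or> restrained \<and> h t (f x) < marker k t e"
  obtains N where "\<And>x. N \<le> x \<Longrightarrow> \<exists>t\<ge>s. prot k t e (h t (f x))"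
proof -
  define E where "E = {x. \<forall>t\<ge>s. \<not> prot k t e (h t (f x))}"
  have "\<exists>t\<ge>s. restrained \<and> h t (f x) < marker k s (Suc e)" if "x \<in> E" for x
  proof -
    obtain t where "s \<le> t" "prot k t e (h t (f x)) \<or> restrained \<and> h t (f x) < marker k t e"
      using enters[of x] by (elim exE conjE)
    with that have t: "s \<le> t" "restrained" "h t (f x) < marker k t e"
      unfolding E_def mem_Collect_eq by metis+
    have "marker k t e \<le> marker k t (Suc e)" by (rule marker_mono) simp
    also have "\<dots> = marker k s (Suc e)" by (rule marker_calm[OF t(1)]) (use calm in auto)
    finally have "h t (f x) < marker k s (Suc e)" using t(3) by simp
    with t show ?thesis by blast
  qed
  then obtain T where T: "\<And>x. x \<in> E \<Longrightarrow> T x \<ge> s \<and> restrained \<and> h (T x) (f x) < marker k s (Suc e)"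
    by metis
  define c where "c x = h (T x) (f x)" for x
  have stable: "h t (f x) = c x" if "x \<in> E" "T x \<le> t" for x t
  proof -
    have "marker k (T x) (Suc e) = marker k s (Suc e)"
      by (rule marker_calm) (use T[OF that(1)] calm in auto)
    then have "prot k t e (h t (f x)) \<or> h t (f x) = c x"
      unfolding c_def using T[OF that(1)] calm by (intro small_rep_mono that) auto
    moreover have "\<not> prot k t e (h t (f x))" using that T[OF that(1)] by (auto simp: E_def)
    ultimately show ?thesis by blast
  qed
  have "inj_on c E"
  proof (rule inj_onI)
    fix x y assume "x \<in> E" "y \<in> E" "c x = c y"
    then have "h (max (T x) (T y)) (f x) = h (max (T x) (T y)) (f y)" by (simp add: stable)
    then show "x = y" using inj by (auto simp: limit_rel_def)
  qed
  moreover have "c ` E \<subseteq> {..<marker k s (Suc e)}" using T by (auto simp: c_def)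
  ultimately have "finite E" by (meson finite_lessThan finite_subset finite_imageD)
  then obtain N where "\<forall>x\<in>E. x < N" unfolding finite_nat_set_iff_bounded by blast
  then have "\<exists>t\<ge>s. prot k t e (h t (f x))" if "N \<le> x" for x using that by (fastforce simp: E_def)
  then show ?thesis by (rule that)
qed

end

section \<open>The construction\<close>

lemma ce_enumeration:
  assumes "ce S"
  obtains g where "computable g" "\<And>x. x \<in> S \<longleftrightarrow> (\<exists>d. g d = Suc x)"
proof -
  obtain G where G: "computable G"
    "\<And>f. partial_computable f \<Longrightarrow> \<exists>e. \<forall>x y. f x = Some y \<longleftrightarrow> (\<exists>d. G d = judg e x y)"
    using universal_enumeration by blast
  obtain f where "partial_computable f" "S = dom f" using assms by (auto simp: ce_def)
  with G(2) obtain e where e: "\<And>x y. f x = Some y \<longleftrightarrow> (\<exists>d. G d = judg e x y)" by metis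
  define g where "g d = (if 0 < G d \<and> p1 (G d - 1) = e then Suc (p1 (p2 (G d - 1))) else 0)" for d
  have "computable g" unfolding g_def by (intro computable_intros G(1))
  moreover have "x \<in> S \<longleftrightarrow> (\<exists>d. g d = Suc x)" for x
  proof
    assume "x \<in> S"
    then obtain y d where "G d = judg e x y" using e \<open>S = dom f\<close> by blast
    then show "\<exists>d. g d = Suc x" by (intro exI[of _ d]) (simp add: g_def)
  next
    assume "\<exists>d. g d = Suc x"
    then obtain d where d: "0 < G d" "p1 (G d - 1) = e" "p1 (p2 (G d - 1)) = x"
      by (auto simp: g_def split: if_splits)
    then have "G d = judg e x (p2 (p2 (G d - 1)))" by auto
    then show "x \<in> S" using e \<open>S = dom f\<close> by blast
  qed
  ultimately show ?thesis by (rule that)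
qed

text \<open>Stated outside the locale \<open>collapse\<close>, because \<open>fields_le\<close> uses
  it to prove bounds which that locale assumes.\<close>

lemma rep_le:
  assumes "\<And>j. j < s \<Longrightarrow> P j \<le> j \<and> Q j \<le> j" "a \<le> s"
  shows "rep P Q s a \<le> s"
proof -
  have "rep P Q t a \<le> s" if "t \<le> s" for t
    using that
  proof (induction t)
    case (Suc t)
    then show ?case using assms(1)[of t] by auto
  qed (use assms(2) in simp)
  then show ?thesis by simp
qed

text \<open>The sequences depend on a parameter \<open>z\<close>, because course-of-values recursion
  decodes them from a varying history.\<close>

lemma computable_rep:
  assumes "computable (\<lambda>p. P (p1 p) (p2 p))" "computable (\<lambda>p. Q (p1 p) (p2 p))"
    and "computable s" "computable x"
  shows "computable (\<lambda>z. rep (P z) (Q z) (s z) (x z))"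
proof -
  have *: "rep P Q s x = rec_nat x (\<lambda>j r. if r = P j then Q j else r) s" for P Q s x
    by (induction s) simp_all
  have PQ: "computable (\<lambda>z. P (a z) (b z))" "computable (\<lambda>z. Q (a z) (b z))"
    if "computable a" "computable b" for a b
    using computable_comp[OF assms(1) computable_pair[OF that]]
      computable_comp[OF assms(2) computable_pair[OF that]] by simp_all
  show ?thesis unfolding * by (intro computable_intros PQ assms(3,4))
qed

lemma computable_marker:
  assumes "computable (\<lambda>p. k (p1 p) (p2 p))" "computable s" "computable i"
  shows "computable (\<lambda>z. marker (k z) (s z) (i z))"
proof -
  have *: "marker k s i = rec_nat 0 (\<lambda>j r. if 0 < k j \<and> k j \<le> i then Suc j else r) s" for k s i
    by (induction s) simp_all
  have K: "computable (\<lambda>z. k (a z) (b z))" if "computable a" "computable b" for a b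
    using computable_comp[OF assms(1) computable_pair[OF that]] by simp
  show ?thesis unfolding * by (intro computable_intros K assms(2) computable_comp[OF assms(3)])
qed

lemma decidable_satisfied:
  assumes "computable (\<lambda>p. k (p1 p) (p2 p))" "computable s" "computable e"
  shows "decidable (\<lambda>z. satisfied (k z) (s z) (e z))"
proof -
  have *: "(if satisfied k s e then 1 else 0) =
      rec_nat 0 (\<lambda>j r. if k j = Suc e then 1 else if 0 < k j \<and> k j \<le> e then 0 else r) s" for k s e
    by (induction s) auto
  have K: "computable (\<lambda>z. k (a z) (b z))" if "computable a" "computable b" for a b
    using computable_comp[OF assms(1) computable_pair[OF that]] by simp
  show ?thesis
    unfolding decidable_def * by (intro computable_intros K assms(2) computable_comp[OF assms(3)])
qed

text \<open>The record of a stage consists of the actor and of the collapses in \<open>X\<close> and in \<open>Y\<close>.\<close>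

abbreviation entry :: "nat \<Rightarrow> nat \<Rightarrow> nat \<Rightarrow> nat \<Rightarrow> nat \<Rightarrow> nat" where
  "entry k P Q P' Q' \<equiv> pr k (pr (pr P Q) (pr P' Q'))"

definition actor :: "(nat \<Rightarrow> nat) \<Rightarrow> nat \<Rightarrow> nat" where "actor v s = p1 (v s)"
definition fromX :: "(nat \<Rightarrow> nat) \<Rightarrow> nat \<Rightarrow> nat" where "fromX v s = p1 (p1 (p2 (v s)))"
definition toX :: "(nat \<Rightarrow> nat) \<Rightarrow> nat \<Rightarrow> nat" where "toX v s = p2 (p1 (p2 (v s)))"
definition fromY :: "(nat \<Rightarrow> nat) \<Rightarrow> nat \<Rightarrow> nat" where "fromY v s = p1 (p2 (p2 (v s)))"
definition toY :: "(nat \<Rightarrow> nat) \<Rightarrow> nat \<Rightarrow> nat" where "toY v s = p2 (p2 (p2 (v s)))"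

lemmas fields = actor_def fromX_def toX_def fromY_def toY_def

abbreviation "repX v \<equiv> rep (fromX v) (toX v)"
abbreviation "repY v \<equiv> rep (fromY v) (toY v)"

text \<open>Requirement \<open>e = \<langle>0, f, g\<rangle>\<close> prevents the \<open>f\<close>-preimage of \<open>X\<close> from being the
  \<open>g\<close>-preimage of \<open>Y\<close>; requirements \<open>\<langle>1, f\<rangle>\<close> and \<open>\<langle>2, f\<rangle>\<close> prevent \<open>f\<close> from reducing
  equality to \<open>X\<close> and to \<open>Y\<close>.\<close>

definition meet_ready :: "(nat \<Rightarrow> nat) \<Rightarrow> nat \<Rightarrow> nat \<Rightarrow> nat \<Rightarrow> nat \<Rightarrow> nat \<Rightarrow> bool" where
  "meet_ready v s e a b b' \<longleftrightarrow>
    \<not> prot (actor v) s e (repX v s a) \<and> repY v s b \<noteq> repY v s b' \<and>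
    \<not> (prot (actor v) s e (repY v s b) \<and> prot (actor v) s e (repY v s b') \<and>
       ix (repY v s b) = ix (repY v s b'))"

definition darkX_ready :: "(nat \<Rightarrow> nat) \<Rightarrow> nat \<Rightarrow> nat \<Rightarrow> nat \<Rightarrow> bool" where
  "darkX_ready v s e a \<longleftrightarrow> \<not> prot (actor v) s e (repX v s a)"

text \<open>The lower bound is the restraint in \<open>Y\<close>, which spares what stronger
  requirements keep apart.\<close>

definition darkY_ready :: "(nat \<Rightarrow> nat) \<Rightarrow> nat \<Rightarrow> nat \<Rightarrow> nat \<Rightarrow> bool" where
  "darkY_ready v s e a \<longleftrightarrow>
    \<not> prot (actor v) s e (repY v s a) \<and> marker (actor v) s e \<le> repY v s a"

abbreviation code :: "nat \<Rightarrow> nat" where "code t \<equiv> p1 (t - 1)"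
abbreviation arg :: "nat \<Rightarrow> nat" where "arg t \<equiv> p1 (p2 (t - 1))"
abbreviation outp :: "nat \<Rightarrow> nat" where "outp t \<equiv> p2 (p2 (t - 1))"

definition computes :: "nat \<Rightarrow> nat \<Rightarrow> bool" where
  "computes t e \<longleftrightarrow> 0 < t \<and> code t = e"

text \<open>The judgements give \<open>f z\<close>, \<open>f z'\<close>, \<open>g z\<close>,
  \<open>g z'\<close> in this order. Bounding the outputs by \<open>s\<close> keeps the
  representatives involved at most \<open>s\<close>.\<close>

definition meet_request :: "(nat \<Rightarrow> nat) \<Rightarrow> nat \<Rightarrow> nat \<Rightarrow> nat \<Rightarrow> nat \<Rightarrow> nat \<Rightarrow> nat \<Rightarrow> bool" where
  "meet_request v s e t1 t2 t3 t4 \<longleftrightarrow> p1 e = 0 \<and>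
    computes t1 (p1 (p2 e)) \<and> computes t2 (p1 (p2 e)) \<and> computes t3 (p2 (p2 e)) \<and> computes t4 (p2 (p2 e)) \<and>
    arg t1 = arg t3 \<and> arg t2 = arg t4 \<and> outp t1 \<le> s \<and> outp t2 \<le> s \<and> outp t3 \<le> s \<and> outp t4 \<le> s \<and>
    meet_ready v s e (outp t1) (outp t3) (outp t4)"

definition dark_request :: "nat \<Rightarrow> nat \<Rightarrow> nat \<Rightarrow> nat \<Rightarrow> nat \<Rightarrow> bool" where
  "dark_request c s e t1 t2 \<longleftrightarrow> p1 e = c \<and> computes t1 (p2 e) \<and> computes t2 (p2 e) \<and>
    arg t1 \<noteq> arg t2 \<and> outp t1 \<le> s \<and> outp t2 \<le> s"

text \<open>A pair \<open>0 0\<close> redirects \<open>0\<close> to itself and so collapses nothing.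
  A meet action collapses in \<open>X\<close> only, so the inequivalence just found in
  \<open>Y\<close> survives the stage.\<close>

definition action_record :: "(nat \<Rightarrow> nat) \<Rightarrow> nat \<Rightarrow> nat \<Rightarrow> nat \<Rightarrow> nat \<Rightarrow> nat \<Rightarrow> nat \<Rightarrow> nat" where
  "action_record v s e t1 t2 t3 t4 =
    (if satisfied (actor v) s e then entry 0 0 0 0 0
     else if meet_request v s e t1 t2 t3 t4 \<or> dark_request 1 s e t1 t2 \<and> darkX_ready v s e (outp t1)
       then entry (Suc e) (repX v s (outp t1)) (repX v s (outp t2)) 0 0
     else if dark_request 2 s e t1 t2 \<and> darkY_ready v s e (outp t1)
       then entry (Suc e) 0 0 (repY v s (outp t1)) (repY v s (outp t2))
     else entry 0 0 0 0 0)"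

text \<open>A task with elements above the stage number is skipped, to be carried out when it
  recurs.\<close>

definition coding_record :: "(nat \<Rightarrow> nat) \<Rightarrow> nat \<Rightarrow> nat \<Rightarrow> nat \<Rightarrow> nat \<Rightarrow> nat" where
  "coding_record v s i x y =
    (let x' = cell i (marker (actor v) s i) x; y' = cell i (marker (actor v) s i) y in
     if x' \<le> s \<and> y' \<le> s then entry 0 (repX v s x') (repX v s y') (repY v s x') (repY v s y')
     else entry 0 0 0 0 0)"

text \<open>\<open>G\<close> enumerates computations and \<open>g\<close> enumerates the sequence \<open>A\<close>.  The stage number encodes a
  task, each task being encoded by infinitely many stages.\<close>

definition stage :: "(nat \<Rightarrow> nat) \<Rightarrow> (nat \<Rightarrow> nat) \<Rightarrow> (nat \<Rightarrow> nat) \<Rightarrow> nat \<Rightarrow> nat" where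
  "stage G g v s =
    (let q = p1 s; d = p2 q in
     if p1 q = 0
     then if 0 < g d then coding_record v s (code (g d)) (arg (g d)) (outp (g d)) else entry 0 0 0 0 0
     else action_record v s (p1 q - 1)
       (G (p1 (p1 d))) (G (p2 (p1 d))) (G (p1 (p2 d))) (G (p2 (p2 d))))"

section \<open>Locality and computability of a stage\<close>

lemma stage_local:
  assumes "\<And>j. j < s \<Longrightarrow> v j = w j"
  shows "stage G g v s = stage G g w s"
proof -
  have same: "actor v j = actor w j" "fromX v j = fromX w j" "toX v j = toX w j"
    "fromY v j = fromY w j" "toY v j = toY w j" if "j < s" for j
    using assms[OF that] by (simp_all add: fields)
  have rep_cong: "rep P Q t = rep P' Q' t" if "\<And>j. j < t \<Longrightarrow> P j = P' j \<and> Q j = Q' j" for P Q P' Q' t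
    using that by (induction t) auto
  have "marker (actor v) t = marker (actor w) t" if "t \<le> s" for t
    using that same by (induction t) auto
  then have marker: "marker (actor v) s = marker (actor w) s" by simp
  have "satisfied (actor v) t = satisfied (actor w) t" if "t \<le> s" for t
    using that same by (induction t) auto
  then have satisfied: "satisfied (actor v) s = satisfied (actor w) s" by simp
  have rep: "repX v s = repX w s" "repY v s = repY w s"
    using same by (auto intro: rep_cong)
  have prot: "prot (actor v) s = prot (actor w) s"
    by (simp add: fun_eq_iff prot_def marker)
  have "coding_record v s = coding_record w s"
    by (simp add: fun_eq_iff coding_record_def Let_def marker rep)
  moreover have "action_record v s = action_record w s"
    by (intro ext) (simp only: action_record_def meet_request_def meet_ready_def darkX_ready_def
        darkY_ready_def marker satisfied rep prot)
  ultimately show ?thesis by (simp add: stage_def Let_def)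
qed

lemma computable_stage:
  assumes G: "computable G" and g: "computable g" and W: "computable (\<lambda>p. W (p1 p) (p2 p))"
  shows "computable (\<lambda>x. stage G g (W x) (p2 x))"
proof -
  have W': "computable (\<lambda>x. W (a x) (b x))" if "computable a" "computable b" for a b
    using computable_comp[OF W computable_pair[OF that]] by simp
  have RX: "computable (\<lambda>z. repX (W z) (s z) (x z))" if "computable s" "computable x" for s x
    unfolding fields by (rule computable_rep) (intro computable_intros W' that)+
  have RY: "computable (\<lambda>z. repY (W z) (s z) (x z))" if "computable s" "computable x" for s x
    unfolding fields by (rule computable_rep) (intro computable_intros W' that)+
  have M: "computable (\<lambda>z. marker (actor (W z)) (s z) (i z))" if "computable s" "computable i" for s i
    unfolding fields by (rule computable_marker) (intro computable_intros W' that)+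
  have S: "decidable (\<lambda>z. satisfied (actor (W z)) (s z) (e z))" if "computable s" "computable e" for s e
    unfolding fields by (rule decidable_satisfied) (intro computable_intros W' that)+
  have C: "computable (\<lambda>z. coding_record (W z) (s z) (i z) (x z) (y z))"
    if "computable s" "computable i" "computable x" "computable y" for s i x y
    unfolding coding_record_def Let_def by (intro computable_intros RX RY M that)
  have Pr: "decidable (\<lambda>z. prot (actor (W z)) (s z) (e z) (p z))"
    if "computable s" "computable e" "computable p" for s e p
    unfolding prot_def by (intro computable_intros M that)
  have D: "decidable (\<lambda>z. dark_request c (s z) (e z) (t1 z) (t2 z))"
    if "computable s" "computable e" "computable t1" "computable t2" for c s e t1 t2
    unfolding dark_request_def computes_def by (intro computable_intros that)
  have Ac: "computable (\<lambda>z. action_record (W z) (s z) (e z) (t1 z) (t2 z) (t3 z) (t4 z))"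
    if "computable s" "computable e" "computable t1" "computable t2" "computable t3" "computable t4"
    for s e t1 t2 t3 t4
    unfolding action_record_def meet_request_def computes_def meet_ready_def darkX_ready_def darkY_ready_def
    by (intro computable_intros RX RY M S Pr D that)
  show ?thesis
    unfolding stage_def Let_def
    by (intro computable_intros Ac C computable_comp[OF G] computable_comp[OF g])
qed

locale construction =
  fixes A :: "nat \<Rightarrow> nat rel" and G g v :: "nat \<Rightarrow> nat"
  assumes equiv_A: "equiv UNIV (A i)"
    and v_computable: "computable v"
    and universal: "partial_computable f \<Longrightarrow> \<exists>e. \<forall>x y. f x = Some y \<longleftrightarrow> (\<exists>d. G d = judg e x y)"
    and g: "(x, y) \<in> A i \<longleftrightarrow> (\<exists>d. g d = judg i x y)"
    and v: "v s = stage G g v s"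
begin

section \<open>What a stage can do\<close>

lemma judg_components: "0 < t \<Longrightarrow> t = judg (code t) (arg t) (outp t)"
  by simp

lemma stage_cases:
  obtains (idle) "actor v s = 0" "fromX v s = 0" "toX v s = 0" "fromY v s = 0" "toY v s = 0"
  | (coding) i x y where "actor v s = 0" "(x, y) \<in> A i"
      "cell i (marker (actor v) s i) x \<le> s" "cell i (marker (actor v) s i) y \<le> s"
      "fromX v s = repX v s (cell i (marker (actor v) s i) x)"
      "toX v s = repX v s (cell i (marker (actor v) s i) y)"
      "fromY v s = repY v s (cell i (marker (actor v) s i) x)"
      "toY v s = repY v s (cell i (marker (actor v) s i) y)"
  | (meet) e d1 d2 d3 d4 where "actor v s = Suc e" "\<not> satisfied (actor v) s e"
      "meet_request v s e (G d1) (G d2) (G d3) (G d4)"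
      "fromX v s = repX v s (outp (G d1))" "toX v s = repX v s (outp (G d2))" "fromY v s = 0" "toY v s = 0"
  | (darkX) e d1 d2 where "actor v s = Suc e" "\<not> satisfied (actor v) s e"
      "dark_request 1 s e (G d1) (G d2)" "darkX_ready v s e (outp (G d1))"
      "fromX v s = repX v s (outp (G d1))" "toX v s = repX v s (outp (G d2))" "fromY v s = 0" "toY v s = 0"
  | (darkY) e d1 d2 where "actor v s = Suc e" "\<not> satisfied (actor v) s e"
      "dark_request 2 s e (G d1) (G d2)" "darkY_ready v s e (outp (G d1))"
      "fromY v s = repY v s (outp (G d1))" "toY v s = repY v s (outp (G d2))" "fromX v s = 0" "toX v s = 0"
proof -
  define q where "q = p1 s"
  define d where "d = p2 q"
  define e where "e = p1 q - 1"
  have vs: "v s = (if p1 q = 0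
     then if 0 < g d then coding_record v s (code (g d)) (arg (g d)) (outp (g d)) else entry 0 0 0 0 0
     else action_record v s e
       (G (p1 (p1 d))) (G (p2 (p1 d))) (G (p1 (p2 d))) (G (p2 (p2 d))))"
    by (subst v) (simp add: stage_def q_def d_def e_def Let_def)
  have idle': thesis if "v s = entry 0 0 0 0 0"
    by (rule idle) (simp_all add: fields that)
  show thesis
  proof (cases "p1 q = 0")
    case True
    show thesis
    proof (cases "0 < g d")
      case pos: True
      define i x y where ixy: "i = code (g d)" "x = arg (g d)" "y = outp (g d)"
      have "(x, y) \<in> A i" unfolding g ixy using judg_components[OF pos] by blast
      moreover have vs': "v s = coding_record v s i x y" using vs True pos by (simp add: ixy)
      ultimately show thesis
        using idle' coding[of x y i]
        by (cases "cell i (marker (actor v) s i) x \<le> s \<and> cell i (marker (actor v) s i) y \<le> s")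
          (simp_all add: coding_record_def fields Let_def)
    next
      case False
      with True vs show thesis by (intro idle') simp
    qed
  next
    case False
    then have "v s = action_record v s e
       (G (p1 (p1 d))) (G (p2 (p1 d))) (G (p1 (p2 d))) (G (p2 (p2 d)))" using vs by simp
    then show thesis
      using idle' meet[of e] darkX[of e] darkY[of e]
      unfolding action_record_def by (auto simp: fields split: if_splits)
  qed
qed

lemma fields_le: "fromX v s \<le> s \<and> toX v s \<le> s \<and> fromY v s \<le> s \<and> toY v s \<le> s"
proof (induction s rule: less_induct)
  case (less s)
  then have le: "repX v s a \<le> s" "repY v s a \<le> s" if "a \<le> s" for a
    using that by (auto intro: rep_le)
  show ?case
    by (cases rule: stage_cases[of s])
      (auto simp: meet_request_def dark_request_def intro: le)
qed

lemma coding_stage: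
  assumes "(x, y) \<in> A i" "\<And>s. n \<le> s \<Longrightarrow> marker (actor v) s i = m"
  obtains s where "n \<le> s"
    "fromX v s = repX v s (cell i m x)" "toX v s = repX v s (cell i m y)"
    "fromY v s = repY v s (cell i m x)" "toY v s = repY v s (cell i m y)"
proof -
  obtain d where d: "g d = judg i x y" using assms(1) g by blast
  \<comment> \<open>The free component of the stage number; it pushes the stage past
    \<open>n\<close> and past both elements, so that the size test succeeds.\<close>
  define b where "b = n + cell i m x + cell i m y"
  define s where "s = pr (pr 0 d) b"
  have "b \<le> s" unfolding s_def by (rule le_prod_encode_2)
  then have bounds: "n \<le> s" "cell i m x \<le> s" "cell i m y \<le> s" by (simp_all add: b_def)
  have "v s = stage G g v s" by (rule v)
  also have "\<dots> = coding_record v s i x y" by (simp add: stage_def s_def d Let_def)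
  also have "\<dots> = entry 0 (repX v s (cell i m x)) (repX v s (cell i m y))
      (repY v s (cell i m x)) (repY v s (cell i m y))"
    using bounds assms(2) by (simp add: coding_record_def Let_def)
  finally have "v s = \<dots>" .
  then show thesis by (intro that[of s] bounds(1)) (simp_all add: fromX_def toX_def fromY_def toY_def)
qed

lemma action_stage:
  obtains s where "n \<le> s" "v s = action_record v s e (G d1) (G d2) (G d3) (G d4)"
proof -
  define s where "s = pr (pr (Suc e) (pr (pr d1 d2) (pr d3 d4))) n"
  have "v s = stage G g v s" by (rule v)
  also have "\<dots> = action_record v s e (G d1) (G d2) (G d3) (G d4)"
    by (simp add: stage_def s_def Let_def)
  finally have "v s = \<dots>" .
  moreover have "n \<le> s" unfolding s_def by (rule le_prod_encode_2)
  ultimately show thesis using that by blast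
qed

sublocale X: collapse A "actor v" "fromX v" "toX v" False
proof
  show "equiv UNIV (A i)" for i by (rule equiv_A)
  show "computable (\<lambda>p. repX v (p1 p) (p2 p))"
    unfolding fromX_def toX_def
    by (rule computable_rep) (intro computable_intros computable_comp[OF v_computable])+
  show "\<not> satisfied (actor v) s e" if "actor v s = Suc e" for s e
    using that by (cases rule: stage_cases[of s]) auto
  show "fromX v s \<le> s" "toX v s \<le> s" for s using fields_le by blast+
  show "\<exists>i x y. (x, y) \<in> A i \<and> fromX v s = repX v s (cell i (marker (actor v) s i) x) \<and>
      toX v s = repX v s (cell i (marker (actor v) s i) y)"
    if "actor v s = 0" "fromX v s \<noteq> toX v s" for s
    using that by (cases rule: stage_cases[of s]) auto
  show "(\<exists>a. fromX v s = repX v s a) \<and> (\<exists>a. toX v s = repX v s a) \<and>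
      \<not> prot (actor v) s e (fromX v s) \<and> (False \<longrightarrow> marker (actor v) s e \<le> fromX v s)"
    if "actor v s = Suc e" "fromX v s \<noteq> toX v s" for s e
    using that
    by (cases rule: stage_cases[of s]) (auto simp: meet_request_def meet_ready_def darkX_ready_def)
  show "\<exists>s\<ge>n. fromX v s = repX v s (cell i m x) \<and> toX v s = repX v s (cell i m y)"
    if "(x, y) \<in> A i" "\<And>s. n \<le> s \<Longrightarrow> marker (actor v) s i = m" for x y i n m
    using coding_stage[OF that] by metis
qed

sublocale Y: collapse A "actor v" "fromY v" "toY v" True
proof
  show "equiv UNIV (A i)" for i by (rule equiv_A)
  show "computable (\<lambda>p. repY v (p1 p) (p2 p))"
    unfolding fromY_def toY_def
    by (rule computable_rep) (intro computable_intros computable_comp[OF v_computable])+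
  show "\<not> satisfied (actor v) s e" if "actor v s = Suc e" for s e
    using that by (rule X.act_unsatisfied)
  show "fromY v s \<le> s" "toY v s \<le> s" for s using fields_le by blast+
  show "\<exists>i x y. (x, y) \<in> A i \<and> fromY v s = repY v s (cell i (marker (actor v) s i) x) \<and>
      toY v s = repY v s (cell i (marker (actor v) s i) y)"
    if "actor v s = 0" "fromY v s \<noteq> toY v s" for s
    using that by (cases rule: stage_cases[of s]) auto
  show "(\<exists>a. fromY v s = repY v s a) \<and> (\<exists>a. toY v s = repY v s a) \<and>
      \<not> prot (actor v) s e (fromY v s) \<and> (True \<longrightarrow> marker (actor v) s e \<le> fromY v s)"
    if "actor v s = Suc e" "fromY v s \<noteq> toY v s" for s e
    using that by (cases rule: stage_cases[of s]) (auto simp: darkY_ready_def)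
  show "\<exists>s\<ge>n. fromY v s = repY v s (cell i m x) \<and> toY v s = repY v s (cell i m y)"
    if "(x, y) \<in> A i" "\<And>s. n \<le> s \<Longrightarrow> marker (actor v) s i = m" for x y i n m
    using coding_stage[OF that] by metis
qed

end

section \<open>Verification of the requirements\<close>

text \<open>By the pigeonhole principle infinitely many values lie in one summand. Listing their
  arguments computably reduces \<open>Id\<close> to that \<open>A i\<close>, contradicting darkness
  as well as finiteness.\<close>

lemma Id_not_reducible_join:
  assumes "\<And>i. dark (A i) \<or> finite (UNIV // A i)" "\<And>i. equiv UNIV (A i)"
  shows "\<not> Id \<preceq> uniform_join (n + 1) A"
proof
  assume "Id \<preceq> uniform_join (n + 1) A"
  then obtain f where f: "computable f" "\<And>x y. (f x, f y) \<in> uniform_join (n + 1) A \<longleftrightarrow> x = y"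
    unfolding reducible_def by auto
  have "finite (range (\<lambda>x. f x mod (n + 1)))"
    by (rule finite_subset[of _ "{..<n + 1}"]) auto
  from pigeonhole_infinite[OF infinite_UNIV_nat this] obtain c
    where inf: "infinite {x. f x mod (n + 1) = f c mod (n + 1)}" by auto
  define i where "i = f c mod (n + 1)"
  define nxt where "nxt x = (LEAST y. x \<le> y \<and> f y mod (n + 1) = i)" for x
  have ex: "\<exists>y. x \<le> y \<and> f y mod (n + 1) = i" for x
    using inf unfolding finite_nat_set_iff_bounded i_def by (auto simp: not_less)
  have nxt: "x \<le> nxt x \<and> f (nxt x) mod (n + 1) = i" for x
    unfolding nxt_def by (rule LeastI_ex[OF ex])
  have nxt_comp: "computable nxt"
    unfolding nxt_def
    by (rule computable_Least[OF _ ex])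
      (intro computable_intros computable_mod computable_comp[OF f(1)]; simp)
  \<comment> \<open>Lists the arguments with value in summand \<open>i\<close> in increasing
    order.\<close>
  define g where "g = rec_nat (nxt 0) (\<lambda>_ r. nxt (Suc r))"
  have "computable g"
    unfolding g_def by (intro computable_intros computable_comp[OF nxt_comp])
  then have u: "computable (\<lambda>x. f (g x) div (n + 1))"
    by (intro computable_div computable_comp[OF f(1)]) simp_all
  have g: "g 0 = nxt 0" "g (Suc x) = nxt (Suc (g x))" for x by (simp_all add: g_def)
  have "g x < g (Suc x)" for x using nxt[of "Suc (g x)"] g(2)[of x] by simp
  then have inj: "g x = g y \<longleftrightarrow> x = y" for x y
    using strict_mono_Suc_iff[of g] strict_mono_eq by blast
  have "f (g x) mod (n + 1) = i" for x
    using nxt by (cases x) (simp_all add: g)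
  then have red: "(f (g x) div (n + 1), f (g y) div (n + 1)) \<in> A i \<longleftrightarrow> x = y" for x y
    using f(2)[of "g x" "g y"] inj[of x y] unfolding uniform_join_iff by metis
  from assms(1)[of i] show False
  proof
    assume "dark (A i)"
    then show False using u red unfolding dark_def reducible_def by auto
  next
    assume "finite (UNIV // A i)"
    moreover have "inj (\<lambda>x. A i `` {f (g x) div (n + 1)})"
      by (rule injI) (use assms(2)[of i] red in \<open>simp add: eq_equiv_class_iff\<close>)
    moreover have "range (\<lambda>x. A i `` {f (g x) div (n + 1)}) \<subseteq> UNIV // A i"
      by (auto intro: quotientI)
    ultimately show False by (metis finite_imageD finite_subset infinite_UNIV_nat)
  qed
qed

lemma unsatisfied_mono:
  assumes "\<not> satisfied k s e" "s \<le> t" "\<And>j. s \<le> j \<Longrightarrow> calm k e j"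
  shows "\<not> satisfied k t e"
  using assms(2)
proof (induction t rule: dec_induct)
  case (step t)
  then show ?case using assms(3)[of t] by (auto simp: calm_def)
qed (rule assms(1))

context collapse
begin

lemma reducible_join_one_class:
  assumes "\<And>x y. (x, y) \<in> Z"
  shows "Z \<preceq> uniform_join (n + 1) A"
proof -
  have "(0, 0) \<in> uniform_join (n + 1) A"
    using equiv_A[of 0] unfolding uniform_join_iff by (simp add: equiv_def refl_on_def)
  then show ?thesis
    unfolding reducible_def using assms computable_const[of 0] by blast
qed

text \<open>The numbers \<open>0\<close> to \<open>n\<close> lie in different summands of a join
  that reduces to \<open>limit_rel\<close>; taking \<open>n\<close> as the supposed number of
  classes is contradictory.\<close>

lemma infinite_limit_rel: "infinite (UNIV // limit_rel)"
proof
  assume fin: "finite (UNIV // limit_rel)"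
  define n where "n = card (UNIV // limit_rel)"
  obtain f where f: "\<And>x y. (x, y) \<in> uniform_join (n + 1) A \<longleftrightarrow> (f x, f y) \<in> limit_rel"
    using join_reducible[of n] unfolding reducible_def by blast
  have "inj_on (\<lambda>i. limit_rel `` {f i}) {..<n + 1}"
  proof (rule inj_onI)
    fix i j assume ij: "i \<in> {..<n + 1}" "j \<in> {..<n + 1}" "limit_rel `` {f i} = limit_rel `` {f j}"
    then have "(i, j) \<in> uniform_join (n + 1) A"
      using eq_equiv_class_iff[OF equiv_limit_rel] unfolding f by simp
    then show "i = j" using ij(1,2) unfolding uniform_join_iff by simp
  qed
  then have "card ((\<lambda>i. limit_rel `` {f i}) ` {..<n + 1}) = n + 1" by (simp add: card_image)
  moreover have "(\<lambda>i. limit_rel `` {f i}) ` {..<n + 1} \<subseteq> UNIV // limit_rel"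
    by (auto intro: quotientI)
  ultimately show False using card_mono[OF fin] by (metis n_def not_less_eq_eq order_refl Suc_eq_plus1)
qed

text \<open>Shifting \<open>f\<close> past its finitely many exceptional arguments gives a reduction
  to which \<open>reducible_join\<close> applies.\<close>

lemma Id_reducible_join:
  assumes f: "computable f" and inj: "\<And>x y. (f x, f y) \<in> limit_rel \<longleftrightarrow> x = y"
    and calm: "\<And>j. s \<le> j \<Longrightarrow> calm k e j"
    and enters: "\<And>x. \<exists>t\<ge>s. prot k t e (h t (f x)) \<or> restrained \<and> h t (f x) < marker k t e"
  shows "Id \<preceq> uniform_join (e + 1) A"
proof (rule cofinitely_prot[OF inj calm enters])
  fix N assume N: "\<And>x. N \<le> x \<Longrightarrow> \<exists>t\<ge>s. prot k t e (h t (f x))"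
  show ?thesis
  proof (rule reducible_join[of "\<lambda>x. f (x + N)", OF _ _ calm])
    show "computable (\<lambda>x. f (x + N))" by (intro computable_comp[OF f] computable_intros)
    show "(x, y) \<in> Id \<longleftrightarrow> (f (x + N), f (y + N)) \<in> limit_rel" for x y by (simp add: inj)
    show "\<exists>t\<ge>s. prot k t e (h t (f (x + N)))" for x by (rule N) simp
  qed
qed

end

context construction
begin

section \<open>The meet requirements\<close>

lemma index_of:
  assumes "computable f"
  obtains e where "\<And>x y. (\<exists>d. G d = judg e x y) \<longleftrightarrow> f x = y"
proof -
  obtain e where "\<forall>x y. Some (f x) = Some y \<longleftrightarrow> (\<exists>d. G d = judg e x y)"
    using universal[of "\<lambda>x. Some (f x)"] assms unfolding computable_def by blast
  then show ?thesis using that[of e] by simp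
qed

lemma index_outp:
  assumes "\<And>x y. (\<exists>d. G d = judg e x y) \<longleftrightarrow> f x = y" "computes (G d) e"
  shows "outp (G d) = f (arg (G d))"
proof -
  have "G d = judg e (arg (G d)) (outp (G d))"
    using assms(2) by (auto simp: computes_def)
  then show ?thesis using assms(1) by metis
qed

lemma eventually_calm_actor: obtains s where "\<And>j. s \<le> j \<Longrightarrow> calm (actor v) e j"
  using eventually_calm[of "actor v" e] X.act_unsatisfied by blast

lemma meet_reducible:
  assumes f: "computable f" "\<And>x y. (x, y) \<in> Z \<longleftrightarrow> (f x, f y) \<in> X.limit_rel"
    and f': "computable f'" "\<And>x y. (x, y) \<in> Z \<longleftrightarrow> (f' x, f' y) \<in> Y.limit_rel"
  shows "\<exists>n. Z \<preceq> uniform_join (n + 1) A"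
proof -
  obtain c where c: "\<And>x y. (\<exists>d. G d = judg c x y) \<longleftrightarrow> f x = y" by (rule index_of[OF f(1)]) blast
  obtain c' where c': "\<And>x y. (\<exists>d. G d = judg c' x y) \<longleftrightarrow> f' x = y" by (rule index_of[OF f'(1)]) blast
  define e where "e = pr 0 (pr c c')"
  obtain s where calm: "\<And>j. s \<le> j \<Longrightarrow> calm (actor v) e j" by (rule eventually_calm_actor[of e]) blast
  show ?thesis
  proof (cases "satisfied (actor v) s e")
    case True
    then obtain j where j: "j < s" "actor v j = Suc e" "\<And>l. j < l \<Longrightarrow> l < s \<Longrightarrow> calm (actor v) e l"
      by (rule satisfied_obtain) blast
    with calm have calm_j: "calm (actor v) e l" if "j < l" for l using that by (metis not_less)
    obtain d1 d2 d3 d4 where R: "meet_request v j e (G d1) (G d2) (G d3) (G d4)"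
      and col: "fromX v j = repX v j (outp (G d1))" "toX v j = repX v j (outp (G d2))"
      and Y: "fromY v j = toY v j"
      using j(2) by (cases rule: stage_cases[of j]) (auto simp: dark_request_def e_def)
    define z z' where "z = arg (G d1)" "z' = arg (G d2)"
    from R have outs: "outp (G d1) = f z" "outp (G d2) = f z'" "outp (G d3) = f' z" "outp (G d4) = f' z'"
      using index_outp[OF c] index_outp[OF c'] unfolding meet_request_def z_z'_def e_def by auto
    have "repX v (Suc j) (f z) = repX v (Suc j) (f z')" using col outs by simp
    then have "(z, z') \<in> Z" unfolding f(2) X.limit_rel_def by blast
    then obtain t where "repY v t (f' z) = repY v t (f' z')" unfolding f'(2) Y.limit_rel_def by blast
    then have "repY v (max t (Suc j)) (f' z) = repY v (max t (Suc j)) (f' z')"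
      by (rule Y.rep_eq_mono) simp
    \<comment> \<open>\<open>Y\<close> was unchanged at \<open>j\<close>, and no requirement up to
      \<open>e\<close> has acted since.\<close>
    moreover have "repY v (max t (Suc j)) (f' z) \<noteq> repY v (max t (Suc j)) (f' z')"
      by (rule Y.separation_preserved[OF j(2)])
        (use R outs Y calm_j in \<open>auto simp: meet_request_def meet_ready_def\<close>)
    ultimately show ?thesis by blast
  next
    case False
    \<comment> \<open>A successful test at the chosen stage would make \<open>e\<close> act and
      become satisfied, against \<open>unsat\<close>.\<close>
    have tested: "\<exists>t\<ge>s. \<not> meet_ready v t e (f z) (f' z) (f' z')" for z z'
    proof -
      obtain d1 d2 d3 d4 where d: "G d1 = judg c z (f z)" "G d2 = judg c z' (f z')"
        "G d3 = judg c' z (f' z)" "G d4 = judg c' z' (f' z')"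
        using c c' by metis
      obtain t where t: "s + f z + f z' + f' z + f' z' \<le> t"
        "v t = action_record v t e (G d1) (G d2) (G d3) (G d4)" by (rule action_stage)
      have unsat: "\<not> satisfied (actor v) u e" if "s \<le> u" for u
        by (rule unsatisfied_mono[OF False that calm])
      have "\<not> meet_ready v t e (f z) (f' z) (f' z')"
      proof
        assume "meet_ready v t e (f z) (f' z) (f' z')"
        then have "meet_request v t e (G d1) (G d2) (G d3) (G d4)"
          using t(1) by (simp add: meet_request_def d computes_def e_def)
        then have "v t = entry (Suc e) (repX v t (outp (G d1))) (repX v t (outp (G d2))) 0 0"
          using t unsat[of t] by (simp add: action_record_def)
        then have "satisfied (actor v) (Suc t) e" by (simp add: actor_def)
        then show False using unsat[of "Suc t"] t(1) by simp
      qed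
      then show ?thesis using t(1) by (intro exI[of _ t]) simp
    qed
    show ?thesis
    proof (cases "\<forall>z. \<exists>t\<ge>s. prot (actor v) t e (repX v t (f z))")
      case True
      then have "Z \<preceq> uniform_join (e + 1) A"
        by (intro X.reducible_join[OF f calm]) auto
      then show ?thesis ..
    next
      case False
      \<comment> \<open>Since \<open>f z0\<close> is never protected in \<open>X\<close>, every test
        of \<open>z0\<close> against some \<open>z\<close> must fail because of
        \<open>Y\<close>.\<close>
      then obtain z0 where z0: "\<And>t. s \<le> t \<Longrightarrow> \<not> prot (actor v) t e (repX v t (f z0))" by blast
      have Y: "\<exists>t\<ge>s. repY v t (f' z0) = repY v t (f' z) \<or>
          prot (actor v) t e (repY v t (f' z0)) \<and> prot (actor v) t e (repY v t (f' z))" for z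
        using tested[of z0 z] z0 unfolding meet_ready_def by blast
      show ?thesis
      proof (cases "\<exists>t\<ge>s. prot (actor v) t e (repY v t (f' z0))")
        case True
        then obtain t0 where t0: "s \<le> t0" "prot (actor v) t0 e (repY v t0 (f' z0))" by blast
        have "\<exists>t\<ge>s. prot (actor v) t e (repY v t (f' z))" for z
        proof -
          obtain t where t: "s \<le> t" and or: "repY v t (f' z0) = repY v t (f' z) \<or>
            prot (actor v) t e (repY v t (f' z0)) \<and> prot (actor v) t e (repY v t (f' z))"
            using Y by blast
          from or show ?thesis
          proof
            assume "repY v t (f' z0) = repY v t (f' z)"
            then have "repY v (max t t0) (f' z0) = repY v (max t t0) (f' z)"
              by (rule Y.rep_eq_mono) simp
            moreover have "prot (actor v) (max t t0) e (repY v (max t t0) (f' z0))"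
              by (rule Y.prot_rep_mono[OF _ _ t0(2)]) (use calm t0(1) in auto)
            ultimately show ?thesis using t by (intro exI[of _ "max t t0"]) simp
          qed (use t in blast)
        qed
        then have "Z \<preceq> uniform_join (e + 1) A"
          by (intro Y.reducible_join[OF f' calm]) auto
        then show ?thesis ..
      next
        \<comment> \<open>Here \<open>f' z0\<close> is never protected, so each test fails through
          equality in \<open>Y\<close>, and \<open>Z\<close> has a single class.\<close>
        case False
        have "(f' z0, f' z) \<in> Y.limit_rel" for z
          using Y[of z] False by (auto simp: Y.limit_rel_def)
        then have "(f' x, f' y) \<in> Y.limit_rel" for x y
          using Y.equiv_limit_rel by (meson equiv_def symD transD)
        then have "Z \<preceq> uniform_join (0 + 1) A"
          by (intro Y.reducible_join_one_class) (simp add: f'(2))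
        then show ?thesis ..
      qed
    qed
  qed
qed

lemma exact_pair_limit_rel: "exact_pair A X.limit_rel Y.limit_rel"
  unfolding exact_pair_def
proof (intro conjI allI impI)
  fix Z assume "Z \<preceq> X.limit_rel" "Z \<preceq> Y.limit_rel"
  then show "\<exists>n. Z \<preceq> uniform_join (n + 1) A"
    unfolding reducible_def[of Z X.limit_rel] reducible_def[of Z Y.limit_rel]
    using meet_reducible by blast
qed (rule X.ceer_limit_rel Y.ceer_limit_rel X.join_reducible Y.join_reducible)+

section \<open>The darkness requirements\<close>

lemma dark_tested:
  assumes f: "\<And>x y. (\<exists>d. G d = judg c x y) \<longleftrightarrow> f x = y"
    and unsat: "\<And>u. s \<le> u \<Longrightarrow> \<not> satisfied (actor v) u (pr b c)"
  obtains t where "s \<le> t"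
    "b = 1 \<Longrightarrow> \<not> darkX_ready v t (pr b c) (f x)" "b = 2 \<Longrightarrow> \<not> darkY_ready v t (pr b c) (f x)"
proof -
  \<comment> \<open>Any argument other than \<open>x\<close> could replace \<open>Suc x\<close> as
    partner.\<close>
  obtain d1 d2 where d: "G d1 = judg c x (f x)" "G d2 = judg c (Suc x) (f (Suc x))"
    using f by metis
  obtain t where t: "s + f x + f (Suc x) \<le> t"
    "v t = action_record v t (pr b c) (G d1) (G d2) (G 0) (G 0)" by (rule action_stage)
  have "\<not> (b = 1 \<and> darkX_ready v t (pr b c) (f x) \<or> b = 2 \<and> darkY_ready v t (pr b c) (f x))"
  proof
    assume ready: "b = 1 \<and> darkX_ready v t (pr b c) (f x) \<or> b = 2 \<and> darkY_ready v t (pr b c) (f x)"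
    then have "dark_request b t (pr b c) (G d1) (G d2)"
      using t(1) by (simp add: dark_request_def d computes_def)
    with ready have "p1 (v t) = Suc (pr b c)"
      using unsat[of t] t(1) unfolding t(2) by (auto simp: action_record_def d)
    then have "satisfied (actor v) (Suc t) (pr b c)" by (simp add: actor_def)
    then show False using unsat[of "Suc t"] t(1) by simp
  qed
  then show thesis using t(1) by (intro that[of t]) auto
qed

text \<open>A satisfied requirement has identified the images of two distinct arguments. An
  unsatisfied one finds every value protected, giving an impossible reduction of \<open>Id\<close>
  to a finite join.\<close>

lemma dark_limit_X:
  assumes "\<And>i. dark (A i) \<or> finite (UNIV // A i)"
  shows "dark X.limit_rel"
  unfolding dark_def
proof (intro conjI X.ceer_limit_rel X.infinite_limit_rel notI)
  assume "Id \<preceq> X.limit_rel"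
  then obtain f where f: "computable f" "\<And>x y. (f x, f y) \<in> X.limit_rel \<longleftrightarrow> x = y"
    unfolding reducible_def by auto
  obtain c where c: "\<And>x y. (\<exists>d. G d = judg c x y) \<longleftrightarrow> f x = y" by (rule index_of[OF f(1)]) blast
  define e where "e = pr 1 c"
  obtain s where calm: "\<And>j. s \<le> j \<Longrightarrow> calm (actor v) e j" by (rule eventually_calm_actor[of e]) blast
  show False
  proof (cases "satisfied (actor v) s e")
    case True
    then obtain j where j: "actor v j = Suc e" by (rule satisfied_obtain)
    obtain d1 d2 where R: "dark_request 1 j e (G d1) (G d2)"
      and col: "fromX v j = repX v j (outp (G d1))" "toX v j = repX v j (outp (G d2))"
      using j by (cases rule: stage_cases[of j]) (auto simp: meet_request_def dark_request_def e_def)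
    have "outp (G d1) = f (arg (G d1))" "outp (G d2) = f (arg (G d2))"
      using R index_outp[OF c] unfolding dark_request_def e_def by auto
    then have "repX v (Suc j) (f (arg (G d1))) = repX v (Suc j) (f (arg (G d2)))" using col by simp
    then have "(f (arg (G d1)), f (arg (G d2))) \<in> X.limit_rel" unfolding X.limit_rel_def by blast
    then have "arg (G d1) = arg (G d2)" by (simp only: f(2))
    then show False using R by (simp add: dark_request_def)
  next
    case False
    have unsat: "\<not> satisfied (actor v) u (pr 1 c)" if "s \<le> u" for u
      using unsatisfied_mono[OF False that calm] by (simp add: e_def)
    have "\<exists>t\<ge>s. prot (actor v) t e (repX v t (f x)) \<or> False \<and> repX v t (f x) < marker (actor v) t e" for x
    proof -
      obtain t where "s \<le> t" "\<not> darkX_ready v t e (f x)"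
        using dark_tested[OF c, where s = s and b = 1 and x = x, OF unsat] unfolding e_def by metis
      then show ?thesis by (auto simp: darkX_ready_def)
    qed
    from X.Id_reducible_join[OF f calm this] have "Id \<preceq> uniform_join (e + 1) A" by simp
    then show False using Id_not_reducible_join assms equiv_A by blast
  qed
qed

text \<open>As for \<open>X\<close>, but a test may also fail because the representative lies below
  the marker; \<open>cofinitely_prot\<close> allows for finitely many values that never become
  protected.\<close>

lemma dark_limit_Y:
  assumes "\<And>i. dark (A i) \<or> finite (UNIV // A i)"
  shows "dark Y.limit_rel"
  unfolding dark_def
proof (intro conjI Y.ceer_limit_rel Y.infinite_limit_rel notI)
  assume "Id \<preceq> Y.limit_rel"
  then obtain f where f: "computable f" "\<And>x y. (f x, f y) \<in> Y.limit_rel \<longleftrightarrow> x = y"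
    unfolding reducible_def by auto
  obtain c where c: "\<And>x y. (\<exists>d. G d = judg c x y) \<longleftrightarrow> f x = y" by (rule index_of[OF f(1)]) blast
  define e where "e = pr 2 c"
  obtain s where calm: "\<And>j. s \<le> j \<Longrightarrow> calm (actor v) e j" by (rule eventually_calm_actor[of e]) blast
  show False
  proof (cases "satisfied (actor v) s e")
    case True
    then obtain j where j: "actor v j = Suc e" by (rule satisfied_obtain)
    obtain d1 d2 where R: "dark_request 2 j e (G d1) (G d2)"
      and col: "fromY v j = repY v j (outp (G d1))" "toY v j = repY v j (outp (G d2))"
      using j by (cases rule: stage_cases[of j]) (auto simp: meet_request_def dark_request_def e_def)
    have "outp (G d1) = f (arg (G d1))" "outp (G d2) = f (arg (G d2))"
      using R index_outp[OF c] unfolding dark_request_def e_def by auto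
    then have "repY v (Suc j) (f (arg (G d1))) = repY v (Suc j) (f (arg (G d2)))" using col by simp
    then have "(f (arg (G d1)), f (arg (G d2))) \<in> Y.limit_rel" unfolding Y.limit_rel_def by blast
    then have "arg (G d1) = arg (G d2)" by (simp only: f(2))
    then show False using R by (simp add: dark_request_def)
  next
    case False
    have unsat: "\<not> satisfied (actor v) u (pr 2 c)" if "s \<le> u" for u
      using unsatisfied_mono[OF False that calm] by (simp add: e_def)
    have "\<exists>t\<ge>s. prot (actor v) t e (repY v t (f x)) \<or> True \<and> repY v t (f x) < marker (actor v) t e" for x
    proof -
      obtain t where "s \<le> t" "\<not> darkY_ready v t e (f x)"
        using dark_tested[OF c, where s = s and b = 2 and x = x, OF unsat] unfolding e_def by metis
      then show ?thesis by (auto simp: darkY_ready_def not_le)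
    qed
    from Y.Id_reducible_join[OF f calm this] have "Id \<preceq> uniform_join (e + 1) A" by simp
    then show False using Id_not_reducible_join assms equiv_A by blast
  qed
qed

end

theorem theorem7p2:
  fixes A :: "nat \<Rightarrow> nat rel"
  assumes "\<And>i. ceer (A i)"
    and "uniformly_ce A"
  shows "(\<exists>X Y. exact_pair A X Y) \<and>
    ((\<forall>i. dark (A i) \<or> finite (UNIV // A i)) \<longrightarrow>
      (\<exists>X Y. exact_pair A X Y \<and> dark X \<and> dark Y))"
proof -
  obtain G where G: "computable G"
    "\<And>f. partial_computable f \<Longrightarrow> \<exists>e. \<forall>x y. f x = Some y \<longleftrightarrow> (\<exists>d. G d = judg e x y)"
    using universal_enumeration by blast
  obtain g where g: "computable g"
    "\<And>x. x \<in> {pr i (pr x y) | i x y. (x, y) \<in> A i} \<longleftrightarrow> (\<exists>d. g d = Suc x)"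
    using ce_enumeration[OF assms(2)[unfolded uniformly_ce_def]] by blast
  obtain v where v: "computable v" "\<And>s. v s = stage G g v s"
    using course_of_values[of "stage G g", OF stage_local computable_stage[OF G(1) g(1)]] by blast
  interpret construction A G g v
  proof
    show "equiv UNIV (A i)" for i using assms(1) by (simp add: ceer_def)
    show "(x, y) \<in> A i \<longleftrightarrow> (\<exists>d. g d = judg i x y)" for x y i
      using g(2)[of "pr i (pr x y)"] by simp
  qed (fact v G(2))+
  show ?thesis
    using exact_pair_limit_rel dark_limit_X dark_limit_Y by blast
qed

end
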